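(* Let $m,n\ge 1$, let $G\subseteq \mathrm{GL}_m(\mathbb{C})\times\mathrm{GL}_n(\mathbb{C})$ be a symmetric subgroup with $K=G\cap(\mathrm{U}_m\times\mathrm{U}_n)$, let $\|\cdot\|_1$ be a unitarily invariant matrix norm on $\mathbb{C}^{m\times n}$ and $\|\cdot\|_2$ a unitarily invariant matrix norm on $\mathbb{C}^{n\times m}$. (i) For every nonzero $A\in\mathbb{C}^{m\times n}$, the function $C_A:G/K\to\mathbb{R}$, $$C_A(K(X,Y))=\log\|XAY^{-1}\|_1+\log\|YA^{\dagger}X^{-1}\|_2,$$ is geodesically convex. (ii) For every polynomial system $\mathbf f=(f_1,\dots,f_m)$, $f_i\in\mathbb{C}[x_1,\dots,x_n]$, with $\mathbf f\neq 0$, and every $\xi\in\mathbb{C}^n$ with $D_\xi(\mathbf f)\neq 0$, the function $C_{(\mathbf f,\xi)}:G/K\to\mathbb{R}$, $$C_{(\mathbf f,\xi)}(K(X,Y))=\log\|(X,Y)\cdot\mathbf f\|_W+\log\|Y\,D_\xi(\mathbf f)^{\dagger}X^{-1}\|_2,$$ is geodesically convex.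
   Context: A subgroup $G\subseteq\mathrm{GL}_m(\mathbb{C})\times\mathrm{GL}_n(\mathbb{C})$ is symmetric if it is Zariski closed and $(X,Y)\in G\Rightarrow (X^*,Y^* )\in G$ ($^*$ = conjugate transpose). $K=G\cap(\mathrm{U}_m\times\mathrm{U}_n)$; $\mathrm{Lie}(G)=\{(H_1,H_2): (e^{tH_1},e^{tH_2})\in G\ \forall t\in\mathbb{R}\}$, and $i\mathrm{Lie}(K)$ is the set of pairs of Hermitian matrices in $\mathrm{Lie}(G)$. $G/K=\{Kg: g\in G\}$ is the set of right cosets. A function $f:G/K\to\mathbb{R}$ is geodesically convex if $t\mapsto f(Ke^{tH}g)$ is convex on $\mathbb{R}$ for every $g\in G$ and $H=(H_1,H_2)\in i\mathrm{Lie}(K)$, where $e^{tH}g=(e^{tH_1}X,e^{tH_2}Y)$ for $g=(X,Y)$. $M^\dagger$ denotes the Moore–Penrose pseudoinverse. (The function in (i) equals $\log\kappa(XAY^{-1})$ with $\kappa(B)=\|B\|_1\|B^\dagger\|_2$ whenever $(XAY^{-1})^\dagger=YA^\dagger X^{-1}$, e.g. when $A$ is invertible.) Polynomial actions: $X\in\mathrm{GL}_m(\mathbb{C})$ acts by $(X\cdot\mathbf f)_i=\sum_{j=1}^m X_{ij}f_j$; $Y\in\mathrm{GL}_n(\mathbb{C})$ acts by $Y\cdot\mathbf f=(f_1\circ Y^{-1},\dots,f_m\circ Y^{-1})$; $(X,Y)\cdot\mathbf f=X\cdot(Y\cdot\mathbf f)$. $D_\xi(\mathbf f)\in\mathbb{C}^{m\times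 n}$ is the Jacobian of $\mathbf f$ at $\xi$. Bombieri–Weyl norm: on homogeneous polynomials of degree $e$ in $n$ variables, the inner product with $\langle x^\alpha,x^\beta\rangle=0$ for $\alpha\neq\beta$ and $\langle x^\alpha,x^\alpha\rangle=\alpha_1!\cdots\alpha_n!/e!$ (linear in the first argument, conjugate-linear in the second); for polynomials of bounded degree, $\langle f,g\rangle=\sum_k\langle f^{(k)},g^{(k)}\rangle$ where $f^{(k)}$ is the degree-$k$ homogeneous part; for systems, $\langle\mathbf f,\mathbf g\rangle=\sum_i\langle f_i,g_i\rangle$ and $\|\mathbf f\|_W=\sqrt{\langle\mathbf f,\mathbf f\rangle}$. *)

theory Defs
  imports "HOL-Analysis.Analysis"
begin

text \<open>Matrices: an m x n complex matrix is an element of complex^'n^'m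
  (rows indexed by 'm, columns by 'n); m = CARD('m), n = CARD('n).\<close>

definition cadj :: "complex^('n::finite)^('m::finite) \<Rightarrow> complex^('m::finite)^('n::finite)" where
  "cadj M = (\<chi> i j. cnj (M $ j $ i))"

definition cscale :: "complex \<Rightarrow> complex^('n::finite)^('m::finite) \<Rightarrow> complex^('n::finite)^('m::finite)" where
  "cscale c M = (\<chi> i j. c * M $ i $ j)"

definition unitary :: "complex^('n::finite)^('n::finite) \<Rightarrow> bool" where
  "unitary U \<longleftrightarrow> U ** cadj U = mat 1 \<and> cadj U ** U = mat 1"

definition hermitian :: "complex^('n::finite)^('n::finite) \<Rightarrow> bool" where
  "hermitian H \<longleftrightarrow> cadj H = H"

primrec mpow :: "complex^('n::finite)^('n::finite) \<Rightarrow> nat \<Rightarrow> complex^('n::finite)^('n::finite)" where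
  "mpow H 0 = mat 1"
| "mpow H (Suc k) = H ** mpow H k"

definition mexp :: "complex^('n::finite)^('n::finite) \<Rightarrow> complex^('n::finite)^('n::finite)" where
  "mexp H = (\<Sum>k. (1 / fact k) *\<^sub>R mpow H k)"

definition pinv :: "complex^('n::finite)^('m::finite) \<Rightarrow> complex^('m::finite)^('n::finite)" where
  "pinv A = (THE B. A ** B ** A = A \<and> B ** A ** B = B \<and>
                    cadj (A ** B) = A ** B \<and> cadj (B ** A) = B ** A)"

definition unitarily_invariant_norm :: "(complex^('n::finite)^('m::finite) \<Rightarrow> real) \<Rightarrow> bool" where
  "unitarily_invariant_norm N \<longleftrightarrow>
     (\<forall>A. 0 \<le> N A) \<and> (\<forall>A. N A = 0 \<longleftrightarrow> A = 0) \<and>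
     (\<forall>c A. N (cscale c A) = cmod c * N A) \<and>
     (\<forall>A B. N (A + B) \<le> N A + N B) \<and>
     (\<forall>U V A. unitary U \<longrightarrow> unitary V \<longrightarrow> N (U ** A ** V) = N A)"

type_synonym ('m,'n) gpair = "(complex^'m^'m) \<times> (complex^'n^'n)"

inductive polyfun :: "(('m::finite,'n::finite) gpair \<Rightarrow> complex) \<Rightarrow> bool" where
  const: "polyfun (\<lambda>_. c)"
| coordX: "polyfun (\<lambda>g. fst g $ i $ j)"
| coordY: "polyfun (\<lambda>g. snd g $ i $ j)"
| add: "polyfun p \<Longrightarrow> polyfun q \<Longrightarrow> polyfun (\<lambda>g. p g + q g)"
| mult: "polyfun p \<Longrightarrow> polyfun q \<Longrightarrow> polyfun (\<lambda>g. p g * q g)"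

definition GLpair :: "(('m::finite,'n::finite) gpair) set" where
  "GLpair = {(X, Y). invertible X \<and> invertible Y}"

definition zariski_closed :: "(('m::finite,'n::finite) gpair) set \<Rightarrow> bool" where
  "zariski_closed G \<longleftrightarrow> (\<exists>P. (\<forall>p\<in>P. polyfun p) \<and>
       G = {g \<in> GLpair. \<forall>p\<in>P. p g = 0})"

definition pmul :: "('m::finite,'n::finite) gpair \<Rightarrow> ('m::finite,'n::finite) gpair
                    \<Rightarrow> ('m::finite,'n::finite) gpair" where
  "pmul g h = (fst g ** fst h, snd g ** snd h)"

definition symmetric_subgroup :: "(('m::finite,'n::finite) gpair) set \<Rightarrow> bool" where
  "symmetric_subgroup G \<longleftrightarrow>
     G \<subseteq> GLpair \<and> (mat 1, mat 1) \<in> G \<and>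
     (\<forall>g\<in>G. \<forall>h\<in>G. pmul g h \<in> G) \<and>
     (\<forall>g\<in>G. (matrix_inv (fst g), matrix_inv (snd g)) \<in> G) \<and>
     zariski_closed G \<and>
     (\<forall>g\<in>G. (cadj (fst g), cadj (snd g)) \<in> G)"

definition Kgrp :: "(('m::finite,'n::finite) gpair) set \<Rightarrow> (('m::finite,'n::finite) gpair) set" where
  "Kgrp G = {g \<in> G. unitary (fst g) \<and> unitary (snd g)}"

definition pexp :: "real \<Rightarrow> ('m::finite,'n::finite) gpair \<Rightarrow> ('m::finite,'n::finite) gpair" where
  "pexp t H = (mexp (t *\<^sub>R fst H), mexp (t *\<^sub>R snd H))"

definition LieG :: "(('m::finite,'n::finite) gpair) set \<Rightarrow> (('m::finite,'n::finite) gpair) set" where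
  "LieG G = {H. \<forall>t::real. pexp t H \<in> G}"

definition iLieK :: "(('m::finite,'n::finite) gpair) set \<Rightarrow> (('m::finite,'n::finite) gpair) set" where
  "iLieK G = {H \<in> LieG G. hermitian (fst H) \<and> hermitian (snd H)}"

text \<open>A function on G/K, given by its values on representatives g in G.
  Being a function on G/K means it is constant on right cosets Kg;
  geodesic convexity means t \<mapsto> F(e^{tH} g) is convex.\<close>
definition geodesically_convex ::
  "(('m::finite,'n::finite) gpair) set \<Rightarrow> (('m::finite,'n::finite) gpair \<Rightarrow> real) \<Rightarrow> bool" where
  "geodesically_convex G F \<longleftrightarrow>
     (\<forall>k\<in>Kgrp G. \<forall>g\<in>G. F (pmul k g) = F g) \<and>
     (\<forall>g\<in>G. \<forall>H\<in>iLieK G. convex_on UNIV (\<lambda>t. F (pmul (pexp t H) g)))"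

text \<open>A polynomial in variables indexed by 'n is a finitely supported
  coefficient function on exponent vectors ('n \<Rightarrow> nat).
  A system (f_1,...,f_m) is a map 'm \<Rightarrow> polynomial.\<close>

type_synonym 'n cpoly = "('n \<Rightarrow> nat) \<Rightarrow> complex"

definition is_poly :: "('n::finite) cpoly \<Rightarrow> bool" where
  "is_poly p \<longleftrightarrow> finite {\<alpha>. p \<alpha> \<noteq> 0}"

definition poly_system :: "('m::finite \<Rightarrow> ('n::finite) cpoly) \<Rightarrow> bool" where
  "poly_system f \<longleftrightarrow> (\<forall>i. is_poly (f i))"

definition peval :: "('n::finite) cpoly \<Rightarrow> complex^'n \<Rightarrow> complex" where
  "peval p x = (\<Sum>\<alpha>\<in>{\<alpha>. p \<alpha> \<noteq> 0}. p \<alpha> * (\<Prod>k\<in>UNIV. (x $ k) ^ \<alpha> k))"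

text \<open>Y acts by f_i \<mapsto> f_i \<circ> Y^{-1}; the coefficients of the composed
  polynomial are the unique polynomial coefficients representing this function.\<close>
definition act_Y :: "complex^('n::finite)^('n::finite) \<Rightarrow> ('m::finite \<Rightarrow> ('n::finite) cpoly) \<Rightarrow> ('m::finite \<Rightarrow> ('n::finite) cpoly)" where
  "act_Y Y f = (\<lambda>i. THE q. is_poly q \<and> (\<forall>x. peval q x = peval (f i) (matrix_inv Y *v x)))"

definition act_X :: "complex^('m::finite)^('m::finite) \<Rightarrow> ('m::finite \<Rightarrow> ('n::finite) cpoly) \<Rightarrow> ('m::finite \<Rightarrow> ('n::finite) cpoly)" where
  "act_X X f = (\<lambda>i \<alpha>. \<Sum>j\<in>UNIV. X $ i $ j * f j \<alpha>)"

definition act :: "('m::finite,'n::finite) gpair \<Rightarrow> ('m::finite \<Rightarrow> ('n::finite) cpoly) \<Rightarrow> ('m::finite \<Rightarrow> ('n::finite) cpoly)" where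
  "act g f = act_X (fst g) (act_Y (snd g) f)"

text \<open>Bombieri--Weyl norm: monomials are orthogonal, and
  <x^\<alpha>, x^\<alpha>> = \<alpha>_1! ... \<alpha>_n! / |\<alpha>|!.\<close>
definition bw_norm :: "('m::finite \<Rightarrow> ('n::finite) cpoly) \<Rightarrow> real" where
  "bw_norm f = sqrt (\<Sum>i\<in>UNIV. \<Sum>\<alpha>\<in>{\<alpha>. f i \<alpha> \<noteq> 0}.
       (cmod (f i \<alpha>))\<^sup>2 * (\<Prod>k\<in>UNIV. fact (\<alpha> k)) / fact (\<Sum>k\<in>UNIV. \<alpha> k))"

definition jac_matrix :: "('m::finite \<Rightarrow> ('n::finite) cpoly) \<Rightarrow> complex^'n \<Rightarrow> complex^('n::finite)^('m::finite)" where
  "jac_matrix f \<xi> = (\<chi> i j. \<Sum>\<alpha>\<in>{\<alpha>. f i \<alpha> \<noteq> 0}.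
       f i \<alpha> * of_nat (\<alpha> j) * (\<Prod>k\<in>UNIV. (\<xi> $ k) ^ (if k = j then \<alpha> k - 1 else \<alpha> k)))"

end

theory Submission
  imports Defs "HOL-Combinatorics.Multiset_Permutations"
begin

text \<open>For Hermitian \<open>H1\<close>, \<open>H2\<close> and a unitarily invariant norm \<open>N\<close>, put
  \<open>F z = exp (c z) exp (z H1) B exp (- z H2)\<close> with \<open>c\<close> real. It is entire in \<open>z\<close>, and \<open>N (F (t \<plusminus> \<i> h)) = N (F t)\<close>
  since imaginary times act by unitaries. Averaging \<open>F\<close> over \<open>t \<plusminus> h\<close>, \<open>t \<plusminus> \<i> h\<close> reproduces \<open>F t\<close> up to
  \<open>o(h\<^sup>2)\<close>, so the triangle inequality bounds the second difference of \<open>N (F t)\<close> from below by \<open>o(h\<^sup>2)\<close>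
  and \<open>N (F t)\<close> is convex in \<open>t\<close>; having this for every tilt \<open>c\<close> means that the untilted function is
  log-convex. The Bombieri--Weyl norm is the Euclidean norm of symmetric coefficient tensors, on
  which Hermitian directions act by self-adjoint one-parameter groups, and log-convexity is
  Cauchy--Schwarz.\<close>

section \<open>Convexity criteria\<close>

text \<open>If \<open>f\<close> rose above a chord, adding a small convex parabola that vanishes at
  both ends would still leave a positive interior maximum. There second differences are at most 0,
  yet \<open>sd\<close> and the parabola make them at least \<open>e * h\<^sup>2\<close>.\<close>

lemma convex_on_UNIV_second_difference:
  fixes f :: "real \<Rightarrow> real"
  assumes cont: "continuous_on UNIV f"
    and sd: "\<And>t e. e > 0 \<Longrightarrow> \<forall>\<^sub>F h in at_right 0. 2 * f t \<le> f (t + h) + f (t - h) + e * h\<^sup>2"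
  shows "convex_on UNIV f"
proof (rule convex_on_linorderI)
  fix t x y :: real
  assume t: "0 < t" "t < 1" and xy: "x < y"
  define z where "z = (1 - t) * x + t * y"
  define k where "k = (f y - f x) / (y - x)"
  define L where "L = (\<lambda>s. f x + k * (s - x))"
  have zx: "z - x = t * (y - x)" and yz: "y - z = (1 - t) * (y - x)"
    by (simp_all add: z_def algebra_simps)
  have z: "x < z" "z < y"
    using zx yz t xy by (smt (verit) mult_pos_pos)+
  have Lz: "L z = (1 - t) * f x + t * f y"
    using xy zx by (simp add: L_def k_def) (simp add: algebra_simps)
  have "f z \<le> L z"
  proof (rule ccontr)
    assume "\<not> f z \<le> L z"
    define d where "d = f z - L z"
    have d: "d > 0" using \<open>\<not> f z \<le> L z\<close> by (simp add: d_def)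
    \<comment> \<open>This size makes the parabola take away exactly half of the excess
      \<open>d\<close> at \<open>z\<close>, so \<open>\<psi> z\<close> stays positive.\<close>
    define e where "e = d / (2 * ((z - x) * (y - z)))"
    have p: "(z - x) * (y - z) > 0" using z by simp
    then have e: "e > 0" using d by (simp add: e_def)
    define \<psi> where "\<psi> = (\<lambda>s. f s - L s + e * ((s - x) * (s - y)))"
    have "e * ((z - x) * (z - y)) = - (e * ((z - x) * (y - z)))"
      by (simp add: algebra_simps)
    also have "\<dots> = - d / 2" using p z by (simp add: e_def)
    finally have "\<psi> z = d / 2" by (simp add: \<psi>_def d_def)
    then have \<psi>z: "\<psi> z > 0" using d by simp
    have \<psi>xy: "\<psi> x = 0" "\<psi> y = 0" using xy by (simp_all add: \<psi>_def L_def k_def)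
    have "continuous_on {x..y} \<psi>"
      unfolding \<psi>_def L_def
      by (intro continuous_intros continuous_on_subset[OF cont]) auto
    then obtain m where m: "m \<in> {x..y}" "\<forall>s\<in>{x..y}. \<psi> s \<le> \<psi> m"
      using continuous_attains_sup[of "{x..y}" \<psi>] xy by auto
    have "\<psi> m > 0" using m(2) z \<psi>z by (smt (verit) atLeastAtMost_iff)
    then have m': "x < m" "m < y" using m(1) \<psi>xy by (auto simp: less_le)
    have "\<forall>\<^sub>F h in at_right 0. h > (0::real)"
      by (simp add: eventually_at_right_less)
    moreover have "\<forall>\<^sub>F h in at_right 0. h < m - x" "\<forall>\<^sub>F h in at_right 0. h < y - m"
      using m' by (auto intro!: eventually_at_rightI[of 0 _])
    moreover note sd[OF e, of m]
    ultimately have "\<forall>\<^sub>F h in at_right 0. h > 0 \<and> h < m - x \<and> h < y - m \<and>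
        2 * f m \<le> f (m + h) + f (m - h) + e * h\<^sup>2"
      by eventually_elim auto
    then obtain h where h: "h > 0" "h < m - x" "h < y - m"
        "2 * f m \<le> f (m + h) + f (m - h) + e * h\<^sup>2"
      using eventually_happens[of _ "at_right (0::real)"] by (auto simp: trivial_limit_at_right_real)
    have "\<psi> (m + h) \<le> \<psi> m" "\<psi> (m - h) \<le> \<psi> m" using m(2) h by auto
    moreover have "L (m + h) + L (m - h) = 2 * L m"
      by (simp add: L_def algebra_simps)
    moreover have "e * ((m + h - x) * (m + h - y)) + e * ((m - h - x) * (m - h - y))
        = 2 * (e * ((m - x) * (m - y))) + 2 * (e * h\<^sup>2)"
      by (simp add: algebra_simps power2_eq_square)
    moreover have "e * h\<^sup>2 > 0" using e h by simp
    ultimately show False using h(4) unfolding \<psi>_def by linarith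
  qed
  then show "f ((1 - t) *\<^sub>R x + t *\<^sub>R y) \<le> (1 - t) * f x + t * f y"
    using Lz by (simp add: z_def)
qed simp

text \<open>When a tilt equalises the two end values, the convexity bound is their common value;
  taking logarithms and removing the affine term \<open>c * t\<close> leaves the bound for
  \<open>ln (g t)\<close>.\<close>

lemma convex_on_ln_if_exp_tilts_convex:
  fixes g :: "real \<Rightarrow> real"
  assumes pos: "\<And>t. g t > 0"
    and conv: "\<And>c. convex_on UNIV (\<lambda>t. exp (c * t) * g t)"
  shows "convex_on UNIV (\<lambda>t. ln (g t))"
proof (rule convex_on_linorderI)
  fix t x y :: real
  assume t: "0 < t" "t < 1" and xy: "x < y"
  define z where "z = (1 - t) * x + t * y"
  \<comment> \<open>the tilt that makes both end values equal\<close>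
  define c where "c = (ln (g x) - ln (g y)) / (y - x)"
  have "c * (y - x) = ln (g x) - ln (g y)"
    using xy by (simp add: c_def)
  then have "c * y - c * x = ln (g x) - ln (g y)"
    by (simp only: right_diff_distrib)
  then have c: "c * x + ln (g x) = c * y + ln (g y)" by simp
  have e: "exp (c * s) * g s = exp (c * s + ln (g s))" for s
    using pos[of s] by (simp add: exp_add)
  have "exp (c * z) * g z \<le> (1 - t) * (exp (c * x) * g x) + t * (exp (c * y) * g y)"
    using convex_onD[OF conv[of c], of t x y] t by (simp add: z_def)
  also have "\<dots> = exp (c * x + ln (g x))"
    unfolding e c by (simp add: algebra_simps)
  finally have "c * z + ln (g z) \<le> c * x + ln (g x)" by (simp add: e)
  moreover have "c * z = (1 - t) * (c * x) + t * (c * y)" by (simp add: z_def algebra_simps)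
  moreover have "c * x + ln (g x) = (1 - t) * (c * x + ln (g x)) + t * (c * y + ln (g y))"
    unfolding c by (simp add: algebra_simps)
  ultimately have "ln (g z) \<le> (1 - t) * ln (g x) + t * ln (g y)"
    by (simp only: distrib_left)
  then show "ln (g ((1 - t) *\<^sub>R x + t *\<^sub>R y)) \<le> (1 - t) * ln (g x) + t * ln (g y)"
    by (simp add: z_def)
qed simp

section \<open>Matrix exponentials\<close>

lemma matrix_eqI: "(\<And>i j. A $ i $ j = B $ i $ j) \<Longrightarrow> A = B"
  by (simp add: vec_eq_iff)

lemma cadj_nth [simp]: "cadj M $ i $ j = cnj (M $ j $ i)"
  by (simp add: cadj_def)

lemma cscale_nth [simp]: "cscale c M $ i $ j = c * M $ i $ j"
  by (simp add: cscale_def)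

lemma cadj_cadj [simp]: "cadj (cadj M) = M"
  by (rule matrix_eqI) simp

lemma cadj_mat_1 [simp]: "cadj (mat 1) = mat 1"
  by (rule matrix_eqI) (simp add: mat_def)

lemma cadj_matrix_mult: "cadj (A ** B) = cadj B ** cadj A"
  by (rule matrix_eqI) (simp add: matrix_matrix_mult_def mult.commute)

lemma scaleR_eq_cscale: "r *\<^sub>R M = cscale (complex_of_real r) M"
  by (rule matrix_eqI) (simp add: scaleR_conv_of_real[where 'a=complex])

lemma cscale_mult_left: "cscale c A ** B = cscale c (A ** B)"
  by (rule matrix_eqI) (simp add: matrix_matrix_mult_def sum_distrib_left mult.assoc)

lemma cscale_mult_right: "A ** cscale c B = cscale c (A ** B)"
  by (rule matrix_eqI) (simp add: matrix_matrix_mult_def sum_distrib_left mult_ac)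

lemma unitary_cadj: "unitary U \<Longrightarrow> unitary (cadj U)"
  by (simp add: unitary_def)

lemma matrix_inv_mult:
  assumes "invertible (A :: 'a::semiring_1^'n^'m)"
  shows matrix_inv_right: "A ** matrix_inv A = mat 1"
    and matrix_inv_left: "matrix_inv A ** A = mat 1"
proof -
  have "A ** matrix_inv A = mat 1 \<and> matrix_inv A ** A = mat 1"
    unfolding matrix_inv_def using assms unfolding invertible_def by (rule someI_ex)
  then show "A ** matrix_inv A = mat 1" "matrix_inv A ** A = mat 1" by auto
qed

lemma matrix_inv_eqI:
  assumes "A ** B = mat 1" "B ** (A :: 'a::semiring_1^'n^'m) = mat 1"
  shows "matrix_inv A = B"
proof -
  have "invertible A" using assms by (auto simp: invertible_def)
  then have "matrix_inv A = matrix_inv A ** (A ** B)"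
    using assms by simp
  also have "\<dots> = B"
    using \<open>invertible A\<close> by (simp add: matrix_mul_assoc matrix_inv_left)
  finally show ?thesis .
qed

lemma matrix_inv_matrix_mult:
  assumes "invertible (A :: 'a::semiring_1^'n^'m)" "invertible (B :: 'a^'k^'n)"
  shows "matrix_inv (A ** B) = matrix_inv B ** matrix_inv A"
proof (rule matrix_inv_eqI)
  have "A ** B ** (matrix_inv B ** matrix_inv A) = A ** (B ** matrix_inv B) ** matrix_inv A"
    by (simp only: matrix_mul_assoc)
  then show "A ** B ** (matrix_inv B ** matrix_inv A) = mat 1"
    using assms by (simp add: matrix_inv_right)
  have "matrix_inv B ** matrix_inv A ** (A ** B) = matrix_inv B ** (matrix_inv A ** A) ** B"
    by (simp only: matrix_mul_assoc)
  then show "matrix_inv B ** matrix_inv A ** (A ** B) = mat 1"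
    using assms by (simp add: matrix_inv_left)
qed

lemma unitary_invertible: "unitary U \<Longrightarrow> invertible U"
  by (auto simp: unitary_def invertible_def)

lemma matrix_inv_unitary: "unitary U \<Longrightarrow> matrix_inv U = cadj U"
  by (simp add: unitary_def matrix_inv_eqI)

section \<open>The matrix exponential as an entrywise power series\<close>

lemma mpow_bound:
  obtains C where "C \<ge> 0" "\<And>k i j. cmod (mpow H k $ i $ j) \<le> C ^ k"
proof
  \<comment> \<open>The sum of all entry moduli dominates every absolute row sum, which is what the
    induction over powers consumes.\<close>
  define C where "C = (\<Sum>i\<in>UNIV. \<Sum>j\<in>UNIV. cmod (H $ i $ j))"
  show C0: "C \<ge> 0" by (simp add: C_def sum_nonneg)
  have row: "(\<Sum>l\<in>UNIV. cmod (H $ i $ l)) \<le> C" for i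
    unfolding C_def by (rule member_le_sum[of i]) (auto intro: sum_nonneg)
  show "cmod (mpow H k $ i $ j) \<le> C ^ k" for k i j
  proof (induction k arbitrary: i)
    case 0
    then show ?case by (simp add: mat_def)
  next
    case (Suc k)
    have "cmod (mpow H (Suc k) $ i $ j) \<le> (\<Sum>l\<in>UNIV. cmod (H $ i $ l) * cmod (mpow H k $ l $ j))"
      by (simp add: matrix_matrix_mult_def flip: norm_mult) (rule norm_sum)
    also have "\<dots> \<le> (\<Sum>l\<in>UNIV. cmod (H $ i $ l) * C ^ k)"
      by (intro sum_mono mult_left_mono Suc) auto
    also have "\<dots> \<le> C * C ^ k"
      unfolding sum_distrib_right[symmetric] by (intro mult_right_mono row) (simp add: C0)
    finally show ?case by simp
  qed
qed

lemma mpow_cscale: "mpow (cscale z H) k = cscale (z ^ k) (mpow H k)"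
proof (induction k)
  case 0
  show ?case by (rule matrix_eqI) simp
next
  case (Suc k)
  then show ?case
    by (simp add: cscale_mult_left cscale_mult_right) (rule matrix_eqI, simp add: mult_ac)
qed

lemma mpow_add: "mpow H (k + l) = mpow H k ** mpow H l"
  by (induction k) (simp_all add: matrix_mul_assoc)

lemma mpow_cadj: "mpow (cadj H) k = cadj (mpow H k)"
proof (induction k)
  case (Suc k)
  have "mpow H (Suc k) = mpow H k ** H" using mpow_add[of H k 1] by simp
  with Suc show ?case by (simp only: cadj_matrix_mult mpow.simps)
qed simp

text \<open>Absolute convergence is what the Cauchy product in \<open>mexp_add\<close>
  requires.\<close>

lemma summable_mexp_norm: "summable (\<lambda>k. cmod (mpow H k $ i $ j / fact k * z ^ k))"
proof -
  obtain C where C: "C \<ge> 0" "\<And>k i j. cmod (mpow H k $ i $ j) \<le> C ^ k"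
    using mpow_bound[of H] by blast
  have "summable (\<lambda>k. inverse (fact k) * (C * cmod z) ^ k)"
    by (rule summable_exp)
  then show ?thesis
  proof (rule summable_comparison_test')
    fix k
    show "norm (cmod (mpow H k $ i $ j / fact k * z ^ k)) \<le> inverse (fact k) * (C * cmod z) ^ k"
      using mult_right_mono[OF C(2)[of k i j], of "cmod z ^ k / fact k"]
      by (simp add: norm_mult norm_divide norm_power power_mult_distrib divide_simps)
  qed
qed

text \<open>Turns the matrix series into scalar power series in \<open>z\<close>, to which
  continuity, Cauchy products and Taylor splitting apply. The scalar is complex because imaginary
  times are used later.\<close>

lemma mexp_cscale_sums:
  "(\<lambda>k. mpow H k $ i $ j / fact k * z ^ k) sums (mexp (cscale z H) $ i $ j)"
proof -
  define S where "S = (\<chi> i j. \<Sum>k. mpow H k $ i $ j / fact k * z ^ k)"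
  have s: "(\<lambda>k. mpow H k $ i $ j / fact k * z ^ k) sums (S $ i $ j)" for i j
    unfolding S_def using summable_sums[OF summable_norm_cancel[OF summable_mexp_norm]] by simp
  have "(\<lambda>k. (1 / fact k) *\<^sub>R mpow (cscale z H) k) sums S"
    unfolding sums_def
  proof (intro vec_tendstoI)
    fix i j
    show "(\<lambda>n. (\<Sum>k<n. (1 / fact k) *\<^sub>R mpow (cscale z H) k) $ i $ j) \<longlonglongrightarrow> S $ i $ j"
      using s[of i j, unfolded sums_def]
      by (simp add: mpow_cscale scaleR_conv_of_real[where 'a=complex] mult_ac)
  qed
  then have "mexp (cscale z H) = S" unfolding mexp_def by (rule sums_unique[symmetric])
  then show ?thesis using s by simp
qed

lemma mexp_cscale_nth: "mexp (cscale z H) $ i $ j = (\<Sum>k. mpow H k $ i $ j / fact k * z ^ k)"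
  using mexp_cscale_sums by (rule sums_unique)

lemma mexp_zero [simp]: "mexp (cscale 0 H) = mat 1"
  by (rule matrix_eqI) (simp add: mexp_cscale_nth powser_zero del: times_divide_eq_left)

text \<open>Multiply the entry series by Cauchy's rule and sum over the inner matrix index:
  \<open>mpow_add\<close> collapses the powers and the binomial theorem does the rest.\<close>

lemma mexp_add: "mexp (cscale (z + w) H) = mexp (cscale z H) ** mexp (cscale w H)"
proof (rule matrix_eqI)
  fix i j
  have "(\<lambda>k. \<Sum>l\<in>UNIV. \<Sum>p\<le>k. mpow H p $ i $ l / fact p * z ^ p *
          (mpow H (k - p) $ l $ j / fact (k - p) * w ^ (k - p)))
      sums (\<Sum>l\<in>UNIV. mexp (cscale z H) $ i $ l * mexp (cscale w H) $ l $ j)"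
    unfolding mexp_cscale_nth by (intro sums_sum Cauchy_product_sums summable_mexp_norm)
  moreover have "(\<Sum>l\<in>UNIV. \<Sum>p\<le>k. mpow H p $ i $ l / fact p * z ^ p *
          (mpow H (k - p) $ l $ j / fact (k - p) * w ^ (k - p)))
      = mpow H k $ i $ j / fact k * (z + w) ^ k" for k
  proof -
    have "(\<Sum>l\<in>UNIV. \<Sum>p\<le>k. mpow H p $ i $ l / fact p * z ^ p *
          (mpow H (k - p) $ l $ j / fact (k - p) * w ^ (k - p)))
      = (\<Sum>p\<le>k. z ^ p / fact p * (w ^ (k - p) / fact (k - p)) *
          (\<Sum>l\<in>UNIV. mpow H p $ i $ l * mpow H (k - p) $ l $ j))"
      by (subst sum.swap) (simp add: sum_distrib_left mult_ac)
    also have "\<dots> = (\<Sum>p\<le>k. of_nat (k choose p) * z ^ p * w ^ (k - p) * (mpow H k $ i $ j / fact k))"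
    proof (intro sum.cong refl)
      fix p assume "p \<in> {..k}"
      then have p: "p \<le> k" by simp
      have "(\<Sum>l\<in>UNIV. mpow H p $ i $ l * mpow H (k - p) $ l $ j) = mpow H k $ i $ j"
        using mpow_add[of H p "k - p"] p by (simp add: matrix_matrix_mult_def)
      then show "z ^ p / fact p * (w ^ (k - p) / fact (k - p)) *
          (\<Sum>l\<in>UNIV. mpow H p $ i $ l * mpow H (k - p) $ l $ j)
          = of_nat (k choose p) * z ^ p * w ^ (k - p) * (mpow H k $ i $ j / fact k)"
        using p by (simp add: binomial_fact)
    qed
    also have "\<dots> = mpow H k $ i $ j / fact k * (z + w) ^ k"
      by (simp only: binomial_ring sum_distrib_left mult.commute)
    finally show ?thesis .
  qed
  ultimately have "(\<lambda>k. mpow H k $ i $ j / fact k * (z + w) ^ k)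
      sums (\<Sum>l\<in>UNIV. mexp (cscale z H) $ i $ l * mexp (cscale w H) $ l $ j)" by simp
  then show "mexp (cscale (z + w) H) $ i $ j = (mexp (cscale z H) ** mexp (cscale w H)) $ i $ j"
    using mexp_cscale_sums[of H i j "z + w"] by (simp add: matrix_matrix_mult_def sums_unique2)
qed

lemma cadj_mexp: "cadj (mexp (cscale z H)) = mexp (cscale (cnj z) (cadj H))"
proof (rule matrix_eqI)
  fix i j
  have "(\<lambda>k. cnj (mpow H k $ j $ i / fact k * z ^ k)) sums cnj (mexp (cscale z H) $ j $ i)"
    using mexp_cscale_sums by (subst sums_cnj)
  then show "cadj (mexp (cscale z H)) $ i $ j = mexp (cscale (cnj z) (cadj H)) $ i $ j"
    using mexp_cscale_sums[of "cadj H" i j "cnj z"] by (simp add: mpow_cadj sums_unique2)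
qed

lemma mexp_minus: "mexp (cscale z H) ** mexp (cscale (- z) H) = mat 1"
  using mexp_add[of z "- z" H] by simp

text \<open>For Hermitian \<open>H\<close> the adjoint only conjugates the scalar, and conjugating
  an imaginary scalar negates it, so the adjoint is the inverse.\<close>

lemma unitary_mexp_imaginary:
  assumes "hermitian H"
  shows "unitary (mexp (cscale (\<i> * of_real y) H))"
  using assms mexp_minus[of "\<i> * of_real y" H] mexp_minus[of "- (\<i> * of_real y)" H]
  by (simp add: unitary_def hermitian_def cadj_mexp)

lemma continuous_on_mexp:
  "continuous_on UNIV (\<lambda>z. mexp (cscale z H) $ i $ j)"
  unfolding mexp_cscale_nth continuous_on_eq_continuous_at[OF open_UNIV]
  by (intro ballI isCont_powser_converges_everywhere summable_norm_cancel[OF summable_mexp_norm])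

lemma invertible_mexp: "invertible (mexp (cscale z H))"
  using mexp_minus[of z H] mexp_minus[of "- z" H] by (auto simp: invertible_def)

lemma matrix_inv_mexp: "matrix_inv (mexp (cscale z H)) = mexp (cscale (- z) H)"
  using mexp_minus[of z H] mexp_minus[of "- z" H] by (simp add: matrix_inv_eqI)

section \<open>Unitarily invariant norms\<close>

text \<open>Captures as much of analyticity as the four-point average needs, in a form closed under
  sums and products. Continuity of \<open>r\<close> keeps the remainder factor bounded near
  0.\<close>

definition has_cubic_remainder :: "(complex \<Rightarrow> complex) \<Rightarrow> bool" where
  "has_cubic_remainder u \<longleftrightarrow>
     (\<exists>a b c r. continuous_on UNIV r \<and> (\<forall>z. u z = a + b * z + c * z\<^sup>2 + z ^ 3 * r z))"

text \<open>The remainder factor is the power series with coefficients shifted by three, which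
  converges everywhere as well.\<close>

lemma has_cubic_remainder_powser:
  assumes "\<And>z. summable (\<lambda>k. a k * z ^ k)"
  shows "has_cubic_remainder (\<lambda>z. \<Sum>k. a k * z ^ k)"
proof -
  define r where "r = (\<lambda>z. \<Sum>k. a (k + 3) * z ^ k)"
  have s: "summable (\<lambda>k. a (k + n) * z ^ k)" for n z
    using assms by (simp add: summable_powser_ignore_initial_segment)
  have "continuous_on UNIV r"
    unfolding continuous_on_eq_continuous_at[OF open_UNIV] r_def
    by (intro ballI isCont_powser_converges_everywhere s)
  moreover have "(\<Sum>k. a k * z ^ k) = a 0 + a 1 * z + a 2 * z\<^sup>2 + z ^ 3 * r z" for z
  proof -
    have "z ^ 3 * r z = (\<Sum>k. a (k + 3) * z ^ (k + 3))"
      unfolding r_def using s[of 3 z]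
      by (subst suminf_mult[symmetric]) (auto simp: power_add mult_ac intro!: suminf_cong)
    then show ?thesis
      using suminf_split_initial_segment[OF assms, of z 3] by (simp add: numeral_3_eq_3 numeral_2_eq_2)
  qed
  ultimately show ?thesis unfolding has_cubic_remainder_def by blast
qed

lemma has_cubic_remainder_const: "has_cubic_remainder (\<lambda>_. k)"
  unfolding has_cubic_remainder_def
  by (rule exI[of _ k], rule exI[of _ 0], rule exI[of _ 0], rule exI[of _ "\<lambda>_. 0"]) simp

lemma has_cubic_remainder_add:
  assumes "has_cubic_remainder u" "has_cubic_remainder v"
  shows "has_cubic_remainder (\<lambda>z. u z + v z)"
proof -
  from assms obtain a b c r a' b' c' r' where
    "continuous_on UNIV r" "continuous_on UNIV r'"
    "\<And>z. u z = a + b * z + c * z\<^sup>2 + z ^ 3 * r z" "\<And>z. v z = a' + b' * z + c' * z\<^sup>2 + z ^ 3 * r' z"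
    unfolding has_cubic_remainder_def by blast
  then show ?thesis unfolding has_cubic_remainder_def
    by (intro exI[of _ "a + a'"] exI[of _ "b + b'"] exI[of _ "c + c'"] exI[of _ "\<lambda>z. r z + r' z"])
       (auto simp: algebra_simps intro!: continuous_intros)
qed

lemma has_cubic_remainder_mult:
  assumes "has_cubic_remainder u" "has_cubic_remainder v"
  shows "has_cubic_remainder (\<lambda>z. u z * v z)"
proof -
  from assms obtain a b c r a' b' c' r' where r: "continuous_on UNIV r" "continuous_on UNIV r'"
    and u: "\<And>z. u z = a + b * z + c * z\<^sup>2 + z ^ 3 * r z"
    and v: "\<And>z. v z = a' + b' * z + c' * z\<^sup>2 + z ^ 3 * r' z"
    unfolding has_cubic_remainder_def by blast
  \<comment> \<open>All product terms of order three or higher, divided by \<open>z ^ 3\<close>: the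
    remainder of \<open>u\<close> multiplies the whole of \<open>v\<close>, that of \<open>v\<close>
    only the quadratic part of \<open>u\<close>.\<close>
  define q where "q = (\<lambda>z. b * c' + c * b' + c * c' * z + r z * v z + (a + b * z + c * z\<^sup>2) * r' z)"
  have "continuous_on UNIV q"
    unfolding q_def v by (intro continuous_intros r)
  moreover have "u z * v z = a * a' + (a * b' + b * a') * z + (a * c' + b * b' + c * a') * z\<^sup>2
      + z ^ 3 * q z" for z
    unfolding u[of z] q_def v[of z] by algebra
  ultimately show ?thesis unfolding has_cubic_remainder_def by blast
qed

lemma has_cubic_remainder_sum:
  "(\<And>i. i \<in> I \<Longrightarrow> has_cubic_remainder (u i)) \<Longrightarrow> has_cubic_remainder (\<lambda>z. \<Sum>i\<in>I. u i z)"
  by (induction I rule: infinite_finite_induct)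
     (auto intro: has_cubic_remainder_const has_cubic_remainder_add)

lemma has_cubic_remainder_scale_arg:
  assumes "has_cubic_remainder u"
  shows "has_cubic_remainder (\<lambda>z. u (k * z))"
proof -
  from assms obtain a b c r where
    r: "continuous_on UNIV r" "\<And>z. u z = a + b * z + c * z\<^sup>2 + z ^ 3 * r z"
    unfolding has_cubic_remainder_def by blast
  have "continuous_on UNIV (\<lambda>z. r (k * z))"
    by (rule continuous_on_compose2[OF r(1)]) (auto intro!: continuous_intros)
  with r(2) show ?thesis unfolding has_cubic_remainder_def
    by (intro exI[of _ a] exI[of _ "b * k"] exI[of _ "c * k\<^sup>2"] exI[of _ "\<lambda>z. k ^ 3 * r (k * z)"])
       (auto simp: power_mult_distrib mult_ac intro!: continuous_intros)
qed

lemma has_cubic_remainder_exp: "has_cubic_remainder exp"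
proof -
  have "exp = (\<lambda>z::complex. \<Sum>k. inverse (fact k) * z ^ k)"
    by (auto simp: exp_def scaleR_conv_of_real[where 'a=complex])
  moreover have "summable (\<lambda>k. inverse (fact k) * z ^ k)" for z :: complex
    by (rule summable_exp)
  ultimately show ?thesis using has_cubic_remainder_powser by metis
qed

lemma has_cubic_remainder_mexp: "has_cubic_remainder (\<lambda>z. mexp (cscale z H) $ i $ j)"
  unfolding mexp_cscale_nth
  by (rule has_cubic_remainder_powser[OF summable_norm_cancel[OF summable_mexp_norm]])

text \<open>The fourth roots of unity have vanishing first and second power sums, so averaging
  over them cancels the Taylor terms of order 1 and 2.\<close>
lemma four_point_defect_tendsto_0:
  assumes "has_cubic_remainder u"
  shows "((\<lambda>h::real. (u h + u (- h) + u (\<i> * h) + u (- (\<i> * h)) - 4 * u 0) / of_real (h\<^sup>2))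
          \<longlongrightarrow> 0) (at_right 0)"
proof -
  from assms obtain a b c r where
    r: "continuous_on UNIV r" "\<And>z. u z = a + b * z + c * z\<^sup>2 + z ^ 3 * r z"
    unfolding has_cubic_remainder_def by blast
  \<comment> \<open>The weights 1, -1, \<open>- \<i>\<close>, \<open>\<i>\<close> are the cubes of
    1, -1, \<open>\<i>\<close>, \<open>- \<i>\<close>. Dividing the cubic remainder by
    \<open>h\<^sup>2\<close> leaves one factor \<open>h\<close>, which forces the limit 0.\<close>
  define q where "q = (\<lambda>h::real. h * (r h - r (- h) - \<i> * r (\<i> * h) + \<i> * r (- (\<i> * h))))"
  have cr: "continuous_on UNIV (\<lambda>h::real. r (k * h))" for k
    by (rule continuous_on_compose2[OF r(1)]) (auto intro!: continuous_intros)
  have "continuous_on UNIV q"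
    unfolding q_def using cr[of 1] cr[of "-1"] cr[of \<i>] cr[of "-\<i>"]
    by (intro continuous_intros) simp_all
  then have "isCont q 0" by (simp add: continuous_on_eq_continuous_at)
  then have "(q \<longlongrightarrow> q 0) (at_right 0)"
    by (simp add: continuous_at_imp_continuous_at_within flip: continuous_within)
  then have "(q \<longlongrightarrow> 0) (at_right 0)" by (simp add: q_def)
  moreover have "\<forall>\<^sub>F h in at_right 0. q h
      = (u h + u (- h) + u (\<i> * h) + u (- (\<i> * h)) - 4 * u 0) / of_real (h\<^sup>2)"
    using eventually_at_right_less[of "0::real"]
  proof eventually_elim
    case (elim h)
    have "u h + u (- h) + u (\<i> * h) + u (- (\<i> * h)) - 4 * u 0 = q h * of_real (h\<^sup>2)"
      unfolding r(2) q_def by (simp add: algebra_simps power2_eq_square power3_eq_cube)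
    then show ?case using elim by simp
  qed
  ultimately show ?thesis by (rule Lim_transform_eventually)
qed

section \<open>Estimates and convexity for a unitarily invariant norm\<close>

context
  fixes N :: "complex^('n::finite)^('m::finite) \<Rightarrow> real"
  assumes N: "unitarily_invariant_norm N"
begin

lemma uin_nonneg: "0 \<le> N A"
  and uin_eq_0: "N A = 0 \<longleftrightarrow> A = 0"
  and uin_cscale: "N (cscale c A) = cmod c * N A"
  and uin_triangle: "N (A + B) \<le> N A + N B"
  and uin_unitary: "unitary U \<Longrightarrow> unitary V \<Longrightarrow> N (U ** A ** V) = N A"
  using N unfolding unitarily_invariant_norm_def by blast+

lemma uin_zero: "N 0 = 0"
  by (simp add: uin_eq_0)

lemma uin_sum: "N (\<Sum>i\<in>I. f i) \<le> (\<Sum>i\<in>I. N (f i))"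
proof (induction I rule: infinite_finite_induct)
  case (insert i I)
  then show ?case using uin_triangle[of "f i" "sum f I"] by simp
qed (simp_all add: uin_zero)

text \<open>Expanding \<open>A\<close> in the matrix units \<open>E i j\<close> and applying the
  triangle inequality bounds \<open>N\<close> by the entries, so entrywise limits carry over to
  \<open>N\<close>.\<close>

lemma uin_le_entries:
  obtains K where "\<And>A. N A \<le> K * (\<Sum>i\<in>UNIV. \<Sum>j\<in>UNIV. cmod (A $ i $ j))"
proof
  define E where "E = (\<lambda>i j. (\<chi> k l. if l = j then if k = i then 1 else 0 else 0) :: complex^'n^'m)"
  define K where "K = (\<Sum>i\<in>UNIV. \<Sum>j\<in>UNIV. N (E i j))"
  have K: "N (E i j) \<le> K" for i j
  proof -
    have "N (E i j) \<le> (\<Sum>j\<in>UNIV. N (E i j))"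
      by (rule member_le_sum) (auto simp: uin_nonneg)
    also have "\<dots> \<le> K"
      unfolding K_def by (rule member_le_sum) (auto simp: uin_nonneg intro!: sum_nonneg)
    finally show ?thesis .
  qed
  fix A
  have "(\<Sum>i\<in>UNIV. \<Sum>j\<in>UNIV. cscale (A $ i $ j) (E i j)) $ k $ l = A $ k $ l" for k l
    by (simp add: E_def if_distrib[of "\<lambda>x. _ * x"] cong: if_cong)
  then have "A = (\<Sum>i\<in>UNIV. \<Sum>j\<in>UNIV. cscale (A $ i $ j) (E i j))"
    by (intro matrix_eqI) simp
  then have "N A = N (\<Sum>i\<in>UNIV. \<Sum>j\<in>UNIV. cscale (A $ i $ j) (E i j))"
    by (rule arg_cong)
  also have "\<dots> \<le> (\<Sum>i\<in>UNIV. N (\<Sum>j\<in>UNIV. cscale (A $ i $ j) (E i j)))"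
    by (rule uin_sum)
  also have "\<dots> \<le> (\<Sum>i\<in>UNIV. \<Sum>j\<in>UNIV. cmod (A $ i $ j) * N (E i j))"
    by (intro sum_mono order.trans[OF uin_sum]) (simp add: uin_cscale)
  also have "\<dots> \<le> (\<Sum>i\<in>UNIV. \<Sum>j\<in>UNIV. cmod (A $ i $ j) * K)"
    by (intro sum_mono mult_left_mono K) auto
  finally show "N A \<le> K * (\<Sum>i\<in>UNIV. \<Sum>j\<in>UNIV. cmod (A $ i $ j))"
    by (simp add: sum_distrib_left mult.commute)
qed

text \<open>By the reverse triangle inequality and the entry bound, \<open>N\<close> is Lipschitz
  with respect to the sum of entry moduli.\<close>

lemma continuous_on_uin:
  assumes "\<And>i j. continuous_on UNIV (\<lambda>t::real. F t $ i $ j)"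
  shows "continuous_on UNIV (\<lambda>t. N (F t))"
proof -
  obtain K where K: "\<And>A. N A \<le> K * (\<Sum>i\<in>UNIV. \<Sum>j\<in>UNIV. cmod (A $ i $ j))"
    using uin_le_entries by blast
  have diff: "\<bar>N A - N B\<bar> \<le> K * (\<Sum>i\<in>UNIV. \<Sum>j\<in>UNIV. cmod (A $ i $ j - B $ i $ j))" for A B
    using uin_triangle[of "A - B" B] uin_triangle[of "B - A" A] K[of "A - B"] K[of "B - A"]
    by (simp add: norm_minus_commute)
  have "((\<lambda>s. N (F s)) \<longlongrightarrow> N (F t)) (at t)" for t
  proof (rule LIM_zero_cancel, rule Lim_null_comparison)
    show "\<forall>\<^sub>F s in at t. norm (N (F s) - N (F t))
        \<le> K * (\<Sum>i\<in>UNIV. \<Sum>j\<in>UNIV. cmod (F s $ i $ j - F t $ i $ j))"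
      using diff by simp
    have "((\<lambda>s. F s $ i $ j - F t $ i $ j) \<longlongrightarrow> 0) (at t)" for i j
      using assms[of i j] by (auto simp: continuous_on_def intro!: LIM_zero)
    then have "((\<lambda>s. K * (\<Sum>i\<in>UNIV. \<Sum>j\<in>UNIV. cmod (F s $ i $ j - F t $ i $ j)))
        \<longlongrightarrow> K * (\<Sum>i\<in>(UNIV::'m set). \<Sum>j\<in>(UNIV::'n set). cmod 0)) (at t)"
      by (intro tendsto_intros)
    then show "((\<lambda>s. K * (\<Sum>i\<in>UNIV. \<Sum>j\<in>UNIV. cmod (F s $ i $ j - F t $ i $ j)))
        \<longlongrightarrow> 0) (at t)" by simp
  qed
  then show ?thesis by (simp add: continuous_on_def)
qed

lemma uin_convex_tilted:
  fixes B :: "complex^'n^'m" and F :: "complex \<Rightarrow> complex^'n^'m"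
  assumes H: "hermitian H1" "hermitian H2"
  defines "F \<equiv> (\<lambda>z::complex. mexp (cscale z H1) ** B ** mexp (cscale (- z) H2))"
  shows "convex_on UNIV (\<lambda>t::real. exp (c * t) * N (F t))"
proof (rule convex_on_UNIV_second_difference)
  have "continuous_on UNIV (\<lambda>t::real. mexp (cscale (k * t) H) $ i $ j)"
    for k i j and H :: "complex^'k^'k"
    by (rule continuous_on_compose2[OF continuous_on_mexp]) (auto intro!: continuous_intros)
  from this[of 1 H1] this[of "-1" H2] show "continuous_on UNIV (\<lambda>t::real. exp (c * t) * N (F t))"
    unfolding F_def
    by (intro continuous_intros continuous_on_uin) (simp add: matrix_matrix_mult_def continuous_intros)
next
  fix t e :: real
  assume e: "e > 0"
  obtain K where K: "\<And>A. N A \<le> K * (\<Sum>i\<in>UNIV. \<Sum>j\<in>UNIV. cmod (A $ i $ j))"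
    using uin_le_entries by blast
  have F_add: "F (z + w) = mexp (cscale z H1) ** F w ** mexp (cscale (- z) H2)" for z w :: complex
  proof -
    have "- (z + w) = - w + - z" by simp
    then show ?thesis by (simp only: F_def mexp_add matrix_mul_assoc)
  qed
  \<comment> \<open>Recentred so that \<open>t\<close> becomes \<open>z = 0\<close>. Since
    \<open>c\<close> is real, the scalar has modulus \<open>exp (c * t)\<close> at imaginary
    \<open>z\<close>, so the tilt preserves invariance under imaginary times.\<close>
  define G where "G = (\<lambda>z::complex. cscale (exp (c * (t + z))) (F (z + t)))"
  \<comment> \<open>Every entry is a finite combination of exponentials. The form
    \<open>- 1 * z\<close> lets the rule for scaled arguments apply.\<close>
  have G_nth: "G z $ i $ j = exp (c * t) * exp (c * z) *
      (\<Sum>l\<in>UNIV. (\<Sum>k\<in>UNIV. mexp (cscale z H1) $ i $ k * F t $ k $ l)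
        * mexp (cscale (- 1 * z) H2) $ l $ j)" for z :: complex and i j
  proof -
    have "exp (c * (t + z)) = exp (c * t) * exp (c * z)" by (simp add: distrib_left exp_add flip: exp_of_real)
    then show ?thesis by (simp add: G_def F_add matrix_matrix_mult_def)
  qed
  have G_good: "has_cubic_remainder (\<lambda>z. G z $ i $ j)" for i j
    unfolding G_nth
    by (intro has_cubic_remainder_mult has_cubic_remainder_sum has_cubic_remainder_const
        has_cubic_remainder_scale_arg[OF has_cubic_remainder_exp] has_cubic_remainder_mexp
        has_cubic_remainder_scale_arg[OF has_cubic_remainder_mexp])
  have NG: "N (G s) = exp (c * (t + s)) * N (F (t + s))" for s :: real
    by (simp add: G_def uin_cscale add.commute)
  have NG_im: "N (G (\<i> * s)) = N (G 0)" for s :: real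
    using unitary_mexp_imaginary[OF H(1), of s] unitary_mexp_imaginary[OF H(2), of "- s"]
    by (simp add: G_def uin_cscale F_add[of "\<i> * s"] uin_unitary)
  \<comment> \<open>Defect of the four-point average: entrywise \<open>o(h\<^sup>2)\<close>, and
    through the bound with \<open>K\<close> also in \<open>N\<close>.\<close>
  define D where "D = (\<lambda>h::real. G h + G (- h) + G (\<i> * h) + G (- (\<i> * h)) - cscale 4 (G 0))"
  have "((\<lambda>h. D h $ i $ j / of_real (h\<^sup>2)) \<longlongrightarrow> 0) (at_right 0)" for i j
    using four_point_defect_tendsto_0[OF G_good[of i j]] by (simp add: D_def)
  then have "((\<lambda>h. K * (\<Sum>i\<in>UNIV. \<Sum>j\<in>UNIV. cmod (D h $ i $ j / of_real (h\<^sup>2))))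
      \<longlongrightarrow> K * (\<Sum>i\<in>(UNIV::'m set). \<Sum>j\<in>(UNIV::'n set). cmod 0)) (at_right 0)"
    by (intro tendsto_intros)
  then have "\<forall>\<^sub>F h in at_right 0. K * (\<Sum>i\<in>UNIV. \<Sum>j\<in>UNIV. cmod (D h $ i $ j / of_real (h\<^sup>2))) < e"
    using e by (intro order_tendstoD(2)[of _ 0]) auto
  then show "\<forall>\<^sub>F h in at_right 0. 2 * (exp (c * t) * N (F (complex_of_real t)))
         \<le> exp (c * (t + h)) * N (F (complex_of_real (t + h)))
           + exp (c * (t - h)) * N (F (complex_of_real (t - h))) + e * h\<^sup>2"
    using eventually_at_right_less[of "0::real"]
  proof eventually_elim
    case (elim h)
    have "K * (\<Sum>i\<in>UNIV. \<Sum>j\<in>UNIV. cmod (D h $ i $ j)) \<le> e * h\<^sup>2"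
      using elim by (simp add: norm_divide norm_power field_simps flip: sum_divide_distrib)
    then have ND: "N (D h) \<le> e * h\<^sup>2" using K[of "D h"] by linarith
    have "4 * N (G 0) = N (cscale 4 (G 0))" by (simp add: uin_cscale)
    \<comment> \<open>Each of the two imaginary points contributes \<open>N (G 0)\<close>, so two of
      the four copies on the left cancel and a second difference in the real direction
      remains.\<close>
    also have "cscale 4 (G 0) = G h + (G (- h) + (G (\<i> * h) + (G (- (\<i> * h)) + cscale (-1) (D h))))"
      by (rule matrix_eqI) (simp add: D_def)
    also have "N \<dots> \<le> N (G h) + (N (G (- h)) + (N (G (\<i> * h)) + (N (G (- (\<i> * h))) + N (cscale (-1) (D h)))))"
      by (intro order.trans[OF uin_triangle] add_left_mono order.refl)
    also have "\<dots> = N (G h) + N (G (- h)) + 2 * N (G 0) + N (D h)"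
      using NG_im[of h] NG_im[of "- h"] by (simp add: uin_cscale)
    finally have "2 * N (G 0) \<le> N (G h) + N (G (- h)) + e * h\<^sup>2" using ND by linarith
    then show ?case using NG[of 0] NG[of h] NG[of "- h"] by simp
  qed
qed

theorem uin_log_convex:
  assumes H: "hermitian H1" "hermitian H2"
  shows "convex_on UNIV (\<lambda>t::real. ln (N (mexp (t *\<^sub>R H1) ** B ** mexp (- t *\<^sub>R H2))))"
proof (cases "B = 0")
  case True
  have "N (A ** B ** C) = 0" for A C
    using True uin_eq_0 by (simp add: matrix_matrix_mult_def zero_vec_def)
  then show ?thesis
    \<comment> \<open>the logarithm is constant because \<open>ln 0 = 0\<close>\<close>
    by (simp add: convex_on_const)
next
  case False
  define F where "F = (\<lambda>z::complex. mexp (cscale z H1) ** B ** mexp (cscale (- z) H2))"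
  have "N (F t) > 0" for t
  proof -
    \<comment> \<open>Undoing the two invertible exponentials recovers \<open>B\<close>, so
      \<open>F t\<close> cannot vanish.\<close>
    have "mexp (cscale (- t) H1) ** F t ** mexp (cscale t H2)
      = (mexp (cscale (- t) H1) ** mexp (cscale t H1)) ** B ** (mexp (cscale (- t) H2) ** mexp (cscale t H2))"
      by (simp only: F_def matrix_mul_assoc)
    also have "\<dots> = B"
      using mexp_minus[of "- t" H1] mexp_minus[of "- t" H2] by simp
    finally have "F t \<noteq> 0" using False by (auto simp: matrix_matrix_mult_def zero_vec_def)
    then show ?thesis using uin_nonneg[of "F t"] uin_eq_0[of "F t"] by linarith
  qed
  then have "convex_on UNIV (\<lambda>t::real. ln (N (F t)))"
    using uin_convex_tilted[OF H, of _ B] unfolding F_def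
    by (intro convex_on_ln_if_exp_tilts_convex) auto
  then show ?thesis by (simp add: F_def scaleR_eq_cscale)
qed

end

section \<open>Polynomials as symmetric tensors\<close>

text \<open>Words of length \<open>d\<close> index the coordinates of \<open>d\<close>-fold tensors
  over the variables.\<close>

definition words :: "nat \<Rightarrow> 'a list set" where
  "words d = {s. length s = d}"

lemma in_words_iff [simp]: "s \<in> words d \<longleftrightarrow> length s = d"
  by (simp add: words_def)

lemma finite_words [simp]: "finite (words d :: 'a::finite list set)"
  unfolding words_def using finite_lists_length_eq[of "UNIV :: 'a set" d] by simp

lemma words_Suc: "words (Suc d) = (\<lambda>(a, s). a # s) ` (UNIV \<times> words d)"
proof (rule set_eqI)
  fix s :: "'a list"
  show "s \<in> words (Suc d) \<longleftrightarrow> s \<in> (\<lambda>(a, s). a # s) ` (UNIV \<times> words d)"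
    by (cases s) (auto simp: words_def)
qed

text \<open>The distributive law: expanding the product picks one letter per position. It is what
  lets all slots of a tensor transform independently.\<close>

lemma sum_words_prod:
  fixes g :: "nat \<Rightarrow> 'a::finite \<Rightarrow> 'b::comm_semiring_1"
  shows "(\<Sum>s\<in>words d. \<Prod>k<d. g k (s ! k)) = (\<Prod>k<d. \<Sum>a\<in>UNIV. g k a)"
proof (induction d arbitrary: g)
  case 0
  have "words 0 = {[] :: 'a list}" by (auto simp: words_def)
  then show ?case by simp
next
  case (Suc d)
  have inj: "inj_on (\<lambda>(a, s). a # s) (UNIV \<times> words d :: ('a \<times> 'a list) set)"
    by (auto simp: inj_on_def)
  have "(\<Sum>s\<in>words (Suc d). \<Prod>k<Suc d. g k (s ! k))
      = (\<Sum>(a, s)\<in>UNIV \<times> words d. g 0 a * (\<Prod>k<d. g (Suc k) (s ! k)))"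
    unfolding words_Suc sum.reindex[OF inj] prod.lessThan_Suc_shift
    by (intro sum.cong) auto
  also have "\<dots> = (\<Sum>a\<in>UNIV. g 0 a) * (\<Sum>s\<in>words d. \<Prod>k<d. g (Suc k) (s ! k))"
    by (simp add: sum_product sum.cartesian_product)
  also have "\<dots> = (\<Prod>k<Suc d. \<Sum>a\<in>UNIV. g k a)"
    unfolding Suc.IH[of "\<lambda>k. g (Suc k)"] prod.lessThan_Suc_shift by simp
  finally show ?case .
qed

lemma prod_power_count_list:
  fixes x :: "'a::finite \<Rightarrow> 'b::comm_semiring_1"
  shows "(\<Prod>k\<in>UNIV. x k ^ count_list s k) = (\<Prod>k<length s. x (s ! k))"
proof (induction s)
  case (Cons a s)
  have "(\<Prod>k\<in>UNIV. x k ^ count_list (a # s) k)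
      = (\<Prod>k\<in>UNIV. (if k = a then x k else 1) * x k ^ count_list s k)"
    by (intro prod.cong) auto
  also have "\<dots> = x a * (\<Prod>k\<in>UNIV. x k ^ count_list s k)"
    by (simp add: prod.distrib)
  finally show ?case
    using Cons by (simp add: prod.lessThan_Suc_shift del: prod.lessThan_Suc)
qed simp

lemma sum_count_list_UNIV: "(\<Sum>k\<in>UNIV. count_list s k) = length (s :: 'a::finite list)"
  by (rule sum_count_set) auto

lemma count_list_eq_iff: "count_list s = count_list s' \<longleftrightarrow> mset s = mset s'"
  by (auto simp: multiset_eq_iff fun_eq_iff count_mset)

text \<open>Words of content \<open>\<alpha>\<close> are the arrangements of the multiset with
  multiplicities \<open>\<alpha>\<close>, so their number is a multinomial coefficient.\<close>

lemma card_words_with_content: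
  fixes \<alpha> :: "'a::finite \<Rightarrow> nat"
  shows "card {s. count_list s = \<alpha>} * (\<Prod>k\<in>UNIV. fact (\<alpha> k)) = fact (\<Sum>k\<in>UNIV. \<alpha> k)"
proof -
  define A where "A = Abs_multiset \<alpha>"
  have A: "count A = \<alpha>" unfolding A_def by (rule count_Abs_multiset) simp
  have "{s. count_list s = \<alpha>} = permutations_of_multiset A"
    unfolding permutations_of_multiset_def
    by (auto simp: multiset_eq_iff A fun_eq_iff count_mset)
  moreover have "(\<Prod>k\<in>set_mset A. fact (count A k)) = (\<Prod>k\<in>UNIV. fact (\<alpha> k) :: nat)"
    unfolding A by (rule prod.mono_neutral_left) (auto simp: not_in_iff A)
  moreover have "size A = (\<Sum>k\<in>UNIV. \<alpha> k)"
    unfolding size_multiset_overloaded_eq A by (rule sum.mono_neutral_left) (auto simp: not_in_iff A)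
  ultimately show ?thesis using card_permutations_of_multiset_aux[of A] by simp
qed

text \<open>The Bombieri--Weyl weight of a monomial, which is also the reciprocal of the number of
  words with that content.\<close>

definition wt :: "('a::finite \<Rightarrow> nat) \<Rightarrow> real" where
  "wt \<alpha> = (\<Prod>k\<in>UNIV. fact (\<alpha> k)) / fact (\<Sum>k\<in>UNIV. \<alpha> k)"

lemma card_wt: "real (card {s. count_list s = \<alpha>}) * wt \<alpha> = 1"
proof -
  have "real (card {s. count_list s = \<alpha>} * (\<Prod>k\<in>UNIV. fact (\<alpha> k))) = real (fact (\<Sum>k\<in>UNIV. \<alpha> k))"
    by (simp only: card_words_with_content)
  then show ?thesis by (simp add: wt_def)
qed

definition exponents :: "nat \<Rightarrow> ('a::finite \<Rightarrow> nat) set" where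
  "exponents d = {\<alpha>. (\<Sum>k\<in>UNIV. \<alpha> k) = d}"

lemma count_list_in_exponents: "s \<in> words d \<Longrightarrow> count_list s \<in> exponents d"
  by (simp add: exponents_def sum_count_list_UNIV)

lemma words_with_content: "\<alpha> \<in> exponents d \<Longrightarrow> {s \<in> words d. count_list s = \<alpha>} = {s. count_list s = \<alpha>}"
  by (auto simp: exponents_def words_def sum_count_list_UNIV)

lemma exponents_eq: "exponents d = count_list ` words d"
proof -
  have "\<alpha> \<in> count_list ` words d" if "\<alpha> \<in> exponents d" for \<alpha> :: "'a \<Rightarrow> nat"
  proof -
    have "{s. count_list s = \<alpha>} \<noteq> {}"
      using card_wt[of \<alpha>] by (metis card.empty mult_zero_left of_nat_0 zero_neq_one)
    then show ?thesis using words_with_content[OF that] by blast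
  qed
  then show ?thesis using count_list_in_exponents by blast
qed

lemma finite_exponents [simp]: "finite (exponents d)"
  by (simp add: exponents_eq)

lemma sum_words_by_content:
  fixes h :: "'a::finite list \<Rightarrow> 'b::comm_monoid_add"
  shows "(\<Sum>s\<in>words d. h s) = (\<Sum>\<alpha>\<in>exponents d. \<Sum>s | count_list s = \<alpha>. h s)"
proof -
  have "(\<Sum>s\<in>words d. h s) = (\<Sum>\<alpha>\<in>exponents d. \<Sum>s\<in>{s \<in> words d. count_list s = \<alpha>}. h s)"
    by (rule sum.group[symmetric]) (auto simp: count_list_in_exponents)
  also have "\<dots> = (\<Sum>\<alpha>\<in>exponents d. \<Sum>s | count_list s = \<alpha>. h s)"
    by (intro sum.cong refl words_with_content)
  finally show ?thesis .
qed

text \<open>Each exponent vector is spread over its words with total weight 1.\<close>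

lemma sum_exponents_eq_sum_words:
  fixes h :: "('a::finite \<Rightarrow> nat) \<Rightarrow> 'b::real_vector"
  shows "(\<Sum>\<alpha>\<in>exponents d. h \<alpha>) = (\<Sum>s\<in>words d. wt (count_list s) *\<^sub>R h (count_list s))"
proof -
  have "(\<Sum>s\<in>words d. wt (count_list s) *\<^sub>R h (count_list s))
      = (\<Sum>\<alpha>\<in>exponents d. (real (card {s. count_list s = \<alpha>}) * wt \<alpha>) *\<^sub>R h \<alpha>)"
    unfolding sum_words_by_content by (intro sum.cong) (auto simp: sum_constant_scaleR)
  then show ?thesis by (simp add: card_wt)
qed

section \<open>Polynomials of bounded degree in tensor coordinates\<close>

text \<open>A degree bound replaces sums over the support, which varies with the polynomial, by sums
  over one fixed index set.\<close>

definition deg_le :: "'n::finite cpoly \<Rightarrow> nat \<Rightarrow> bool" where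
  "deg_le p D \<longleftrightarrow> (\<forall>\<alpha>. p \<alpha> \<noteq> 0 \<longrightarrow> (\<Sum>k\<in>UNIV. \<alpha> k) \<le> D)"

lemma is_poly_iff_deg_le: "is_poly p \<longleftrightarrow> (\<exists>D. deg_le p D)"
proof
  assume "is_poly p"
  then have "finite ((\<lambda>\<alpha>. \<Sum>k\<in>UNIV. \<alpha> k) ` {\<alpha>. p \<alpha> \<noteq> 0})" by (simp add: is_poly_def)
  then show "\<exists>D. deg_le p D" unfolding finite_nat_set_iff_bounded_le deg_le_def by blast
next
  assume "\<exists>D. deg_le p D"
  then obtain D where "deg_le p D" by blast
  then have "{\<alpha>. p \<alpha> \<noteq> 0} \<subseteq> (\<Union>d\<le>D. exponents d)"
    by (auto simp: deg_le_def exponents_def)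
  then show "is_poly p" unfolding is_poly_def by (rule finite_subset) simp
qed

lemma deg_le_mono: "deg_le p D \<Longrightarrow> D \<le> D' \<Longrightarrow> deg_le p D'"
  by (auto simp: deg_le_def intro: order.trans)

lemma sum_support_by_degree:
  fixes h :: "('n::finite \<Rightarrow> nat) \<Rightarrow> 'b::comm_monoid_add"
  assumes "deg_le p D" "\<And>\<alpha>. p \<alpha> = 0 \<Longrightarrow> h \<alpha> = 0"
  shows "(\<Sum>\<alpha>\<in>{\<alpha>. p \<alpha> \<noteq> 0}. h \<alpha>) = (\<Sum>d\<le>D. \<Sum>\<alpha>\<in>exponents d. h \<alpha>)"
proof -
  have "(\<Sum>d\<le>D. \<Sum>\<alpha>\<in>exponents d. h \<alpha>) = (\<Sum>\<alpha>\<in>(\<Union>d\<le>D. exponents d). h \<alpha>)"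
    by (rule sum.UNION_disjoint[symmetric]) (simp_all, auto simp: exponents_def)
  also have "\<dots> = (\<Sum>\<alpha>\<in>{\<alpha>. p \<alpha> \<noteq> 0}. h \<alpha>)"
  proof (rule sum.mono_neutral_right)
    show "{\<alpha>. p \<alpha> \<noteq> 0} \<subseteq> (\<Union>d\<le>D. exponents d)"
      using assms(1) by (auto simp: deg_le_def exponents_def)
  qed (use assms(2) in auto)
  finally show ?thesis by simp
qed

text \<open>Coefficients of the symmetric tensor whose contraction with \<open>x \<otimes> \<dots> \<otimes> x\<close> is the
  degree \<open>length s\<close> part of \<open>p\<close>; in these coordinates the Bombieri--Weyl norm is the
  Euclidean norm.\<close>
definition tens :: "'n::finite cpoly \<Rightarrow> 'n list \<Rightarrow> complex" where
  "tens p s = complex_of_real (wt (count_list s)) * p (count_list s)"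

lemma peval_eq_tens:
  assumes "deg_le p D"
  shows "peval p x = (\<Sum>d\<le>D. \<Sum>s\<in>words d. tens p s * (\<Prod>k<d. x $ (s ! k)))"
proof -
  have "peval p x = (\<Sum>d\<le>D. \<Sum>\<alpha>\<in>exponents d. p \<alpha> * (\<Prod>k\<in>UNIV. (x $ k) ^ \<alpha> k))"
    unfolding peval_def by (rule sum_support_by_degree[OF assms]) simp
  also have "\<dots> = (\<Sum>d\<le>D. \<Sum>s\<in>words d. tens p s * (\<Prod>k<d. x $ (s ! k)))"
    unfolding sum_exponents_eq_sum_words
    by (intro sum.cong refl)
       (simp add: tens_def prod_power_count_list[of "\<lambda>k. x $ k"] scaleR_conv_of_real mult.assoc)
  finally show ?thesis .
qed

lemma bw_norm_eq_tens:
  assumes "\<And>i. deg_le (f i) D"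
  shows "bw_norm f = sqrt (\<Sum>i\<in>UNIV. \<Sum>d\<le>D. \<Sum>s\<in>words d. (cmod (tens (f i) s))\<^sup>2)"
proof -
  have "(\<Sum>\<alpha>\<in>{\<alpha>. f i \<alpha> \<noteq> 0}. (cmod (f i \<alpha>))\<^sup>2 * (\<Prod>k\<in>UNIV. fact (\<alpha> k)) / fact (\<Sum>k\<in>UNIV. \<alpha> k))
      = (\<Sum>d\<le>D. \<Sum>\<alpha>\<in>exponents d. (cmod (f i \<alpha>))\<^sup>2 * wt \<alpha>)" for i
    using sum_support_by_degree[OF assms, of i "\<lambda>\<alpha>. (cmod (f i \<alpha>))\<^sup>2 * wt \<alpha>"] by (simp add: wt_def)
  also have "\<dots> i = (\<Sum>d\<le>D. \<Sum>s\<in>words d. (cmod (tens (f i) s))\<^sup>2)" for i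
    unfolding sum_exponents_eq_sum_words
    by (intro sum.cong refl)
       (simp add: tens_def norm_mult power_mult_distrib power2_eq_square)
  finally show ?thesis unfolding bw_norm_def by simp
qed

section \<open>Linear substitutions on tensors\<close>

text \<open>Applies \<open>M\<close> to every slot of the symmetric tensor of \<open>p\<close>;
  these are the tensor coordinates of \<open>p\<close> composed with \<open>M\<close>.\<close>

definition push :: "complex^'n^'n \<Rightarrow> 'n::finite cpoly \<Rightarrow> 'n list \<Rightarrow> complex" where
  "push M p s = (\<Sum>r\<in>words (length s). tens p r * (\<Prod>k<length s. M $ (r ! k) $ (s ! k)))"

definition poly_comp :: "complex^'n^'n \<Rightarrow> 'n::finite cpoly \<Rightarrow> 'n cpoly" where
  "poly_comp M p \<alpha> = (\<Sum>s | count_list s = \<alpha>. push M p s)"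

text \<open>The transformed tensor is again symmetric: a rearrangement of \<open>s\<close> can be
  moved onto the summation word \<open>r\<close>, where \<open>tens\<close> sees only the
  content.\<close>

lemma push_cong_content:
  assumes "count_list s = count_list s'"
  shows "push M p s = push M p s'"
proof -
  define d where "d = length s'"
  have "mset s = mset s'" using assms by (simp add: count_list_eq_iff)
  then obtain \<pi> where \<pi>: "\<pi> permutes {..<d}" "permute_list \<pi> s' = s"
    unfolding d_def by (rule mset_eq_permutation)
  have d: "length s = d" using \<pi> d_def by auto
  have inv: "inv \<pi> permutes {..<d}" using \<pi>(1) by (rule permutes_inv)
  have tens_perm: "tens p (permute_list \<sigma> r) = tens p r" if "\<sigma> permutes {..<d}" "r \<in> words d" for \<sigma> r
  proof -
    have "count_list (permute_list \<sigma> r) = count_list r"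
      using that by (simp add: count_list_eq_iff words_def)
    then show ?thesis by (simp add: tens_def)
  qed
  have "push M p s' = (\<Sum>r\<in>words d. tens p r * (\<Prod>k<d. M $ (r ! k) $ (s' ! k)))"
    by (simp add: push_def d_def)
  also have "\<dots> = (\<Sum>r\<in>words d. tens p r * (\<Prod>k<d. M $ (r ! k) $ (s ! k)))"
  proof (rule sum.reindex_bij_witness[of _ "permute_list (inv \<pi>)" "permute_list \<pi>"])
    fix r :: "'a list" assume r: "r \<in> words d"
    then have len: "length r = d" by simp
    show "permute_list \<pi> r \<in> words d" "permute_list (inv \<pi>) r \<in> words d"
      using len by (simp_all add: words_def)
    have "permute_list (inv \<pi>) (permute_list \<pi> r) = permute_list (\<pi> \<circ> inv \<pi>) r"
      using inv len by (simp add: permute_list_compose)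
    then show "permute_list (inv \<pi>) (permute_list \<pi> r) = r"
      using permutes_inv_o(1)[OF \<pi>(1)] by simp
    have "permute_list \<pi> (permute_list (inv \<pi>) r) = permute_list (inv \<pi> \<circ> \<pi>) r"
      using \<pi>(1) len by (simp add: permute_list_compose)
    then show "permute_list \<pi> (permute_list (inv \<pi>) r) = r"
      using permutes_inv_o(2)[OF \<pi>(1)] by simp
    have "(\<Prod>k<d. M $ (r ! k) $ (s' ! k)) = (\<Prod>k<d. M $ (r ! \<pi> k) $ (s' ! \<pi> k))"
      using prod.permute[OF \<pi>(1), of "\<lambda>k. M $ (r ! k) $ (s' ! k)"] by (simp add: o_def)
    also have "\<dots> = (\<Prod>k<d. M $ (permute_list \<pi> r ! k) $ (s ! k))"
      using \<pi> len by (intro prod.cong refl) (auto simp: permute_list_nth d_def)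
    finally show "tens p (permute_list \<pi> r) * (\<Prod>k<d. M $ (permute_list \<pi> r ! k) $ (s ! k))
        = tens p r * (\<Prod>k<d. M $ (r ! k) $ (s' ! k))"
      using tens_perm[OF \<pi>(1) r] by simp
  qed
  also have "\<dots> = push M p s" by (simp add: push_def d)
  finally show ?thesis by simp
qed

text \<open>\<open>push\<close> is constant on each content class, and \<open>wt\<close> cancels the
  size of that class.\<close>

lemma tens_poly_comp: "tens (poly_comp M p) s = push M p s"
proof -
  have "poly_comp M p (count_list s) = (\<Sum>s' | count_list s' = count_list s. push M p s)"
    unfolding poly_comp_def by (intro sum.cong refl push_cong_content) simp
  also have "\<dots> = of_real (real (card {s'. count_list s' = count_list s})) * push M p s"
    by simp
  finally have "tens (poly_comp M p) s
      = of_real (real (card {s'. count_list s' = count_list s}) * wt (count_list s)) * push M p s"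
    unfolding tens_def by simp
  then show ?thesis by (simp only: card_wt of_real_1 mult_1)
qed

lemma deg_le_poly_comp:
  assumes "deg_le p D"
  shows "deg_le (poly_comp M p) D"
  unfolding deg_le_def
proof (intro allI impI)
  fix \<alpha> assume "poly_comp M p \<alpha> \<noteq> 0"
  then obtain s where s: "count_list s = \<alpha>" "push M p s \<noteq> 0"
    unfolding poly_comp_def by (metis (mono_tags, lifting) mem_Collect_eq sum.not_neutral_contains_not_neutral)
  then obtain r where "r \<in> words (length s)" "tens p r \<noteq> 0"
    unfolding push_def by (metis (no_types, lifting) mult_eq_0_iff sum.not_neutral_contains_not_neutral)
  then have "length s \<le> D"
    using assms by (auto simp: deg_le_def tens_def sum_count_list_UNIV dest!: spec[of _ "count_list r"])
  then show "(\<Sum>k\<in>UNIV. \<alpha> k) \<le> D"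
    using s(1) sum_count_list_UNIV[of s] by simp
qed

text \<open>Expanding every coordinate of \<open>M *v x\<close> by \<open>sum_words_prod\<close>
  gives a sum over words whose coefficients are \<open>push M p\<close>.\<close>

lemma peval_poly_comp:
  assumes "deg_le p D"
  shows "peval (poly_comp M p) x = peval p (M *v x)"
proof -
  have "peval p (M *v x) = (\<Sum>d\<le>D. \<Sum>r\<in>words d. tens p r * (\<Prod>k<d. \<Sum>a\<in>UNIV. M $ (r ! k) $ a * x $ a))"
    unfolding peval_eq_tens[OF assms] by (simp add: matrix_vector_mult_def)
  also have "\<dots> = (\<Sum>d\<le>D. \<Sum>r\<in>words d. \<Sum>s\<in>words d.
      tens p r * ((\<Prod>k<d. M $ (r ! k) $ (s ! k)) * (\<Prod>k<d. x $ (s ! k))))"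
    unfolding sum_words_prod[symmetric] by (simp add: sum_distrib_left prod.distrib)
  also have "\<dots> = (\<Sum>d\<le>D. \<Sum>s\<in>words d. push M p s * (\<Prod>k<d. x $ (s ! k)))"
    by (subst sum.swap) (simp add: push_def sum_distrib_right mult.assoc)
  also have "\<dots> = peval (poly_comp M p) x"
    unfolding peval_eq_tens[OF deg_le_poly_comp[OF assms]] tens_poly_comp ..
  finally show ?thesis by simp
qed

section \<open>Uniqueness of coefficients\<close>

text \<open>Induction on the set of variables. As a polynomial in one variable the sum vanishes
  identically, so each coefficient does, and it is a sum of the same kind in the remaining
  variables.\<close>

lemma monomials_independent:
  fixes c :: "('n \<Rightarrow> nat) \<Rightarrow> complex"
  assumes "finite V" "finite S"
    and "\<And>\<alpha> k. \<alpha> \<in> S \<Longrightarrow> k \<notin> V \<Longrightarrow> \<alpha> k = 0"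
    and "\<And>x. (\<Sum>\<alpha>\<in>S. c \<alpha> * (\<Prod>k\<in>V. x k ^ \<alpha> k)) = 0"
    and "\<alpha> \<in> S"
  shows "c \<alpha> = 0"
  using assms
proof (induction V arbitrary: S c \<alpha> rule: finite_induct)
  case empty
  \<comment> \<open>With no variables only the zero exponent is left, so the vanishing sum is the
    single term \<open>c \<alpha>\<close>.\<close>
  then have "S = {\<alpha>}" by (metis (no_types, lifting) empty_iff ext is_singletonI' is_singleton_the_elem singletonD)
  then show ?case using empty.prems(3) by simp
next
  case (insert j W)
  define n where "n = \<alpha> j"
  define u where "u = (\<lambda>x i. \<Sum>\<beta>\<in>{\<beta>\<in>S. \<beta> j = i}. c \<beta> * (\<Prod>k\<in>W. x k ^ \<beta> k))"
  define b where "b = Max ((\<lambda>\<beta>. \<beta> j) ` S)"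
  have b: "\<beta> j \<le> b" if "\<beta> \<in> S" for \<beta> using that insert.prems(1) by (simp add: b_def)
  have u0: "u x n = 0" for x
  proof -
    have "(\<Sum>i\<le>b. u x i * z ^ i) = 0" for z
    proof -
      have "(\<Sum>i\<le>b. u x i * z ^ i) = (\<Sum>i\<le>b. \<Sum>\<beta>\<in>{\<beta>\<in>S. \<beta> j = i}. c \<beta> * (\<Prod>k\<in>W. x k ^ \<beta> k) * z ^ \<beta> j)"
        unfolding u_def sum_distrib_right by (intro sum.cong refl) auto
      also have "\<dots> = (\<Sum>\<beta>\<in>S. c \<beta> * (\<Prod>k\<in>W. x k ^ \<beta> k) * z ^ \<beta> j)"
        using insert.prems(1) b by (intro sum.group) auto
      also have "\<dots> = (\<Sum>\<beta>\<in>S. c \<beta> * (\<Prod>k\<in>insert j W. (x(j := z)) k ^ \<beta> k))"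
      proof (intro sum.cong refl)
        fix \<beta>
        have "(\<Prod>k\<in>W. (x(j := z)) k ^ \<beta> k) = (\<Prod>k\<in>W. x k ^ \<beta> k)"
          using insert.hyps by (intro prod.cong) auto
        then show "c \<beta> * (\<Prod>k\<in>W. x k ^ \<beta> k) * z ^ \<beta> j = c \<beta> * (\<Prod>k\<in>insert j W. (x(j := z)) k ^ \<beta> k)"
          using insert.hyps by (simp add: mult_ac)
      qed
      finally show ?thesis using insert.prems(3) by simp
    qed
    then show ?thesis
      using polyfun_eq_0[of "u x" b] b[OF insert.prems(4)] by (simp add: n_def)
  qed
  \<comment> \<open>Exponents at \<open>j\<close> are reset to 0 to fit the support condition for
    \<open>W\<close>; \<open>c'\<close> puts \<open>n\<close> back to recover the original
    coefficient.\<close>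
  define S' where "S' = (\<lambda>\<beta>. \<beta>(j := 0)) ` {\<beta>\<in>S. \<beta> j = n}"
  define c' where "c' = (\<lambda>\<beta>. c (\<beta>(j := n)))"
  have inj: "inj_on (\<lambda>\<beta>. \<beta>(j := 0)) {\<beta>\<in>S. \<beta> j = n}"
  proof (rule inj_onI)
    fix \<beta> \<gamma> assume "\<beta> \<in> {\<beta>\<in>S. \<beta> j = n}" "\<gamma> \<in> {\<beta>\<in>S. \<beta> j = n}" "\<beta>(j := 0) = \<gamma>(j := (0::nat))"
    then show "\<beta> = \<gamma>" by (metis (mono_tags, lifting) fun_upd_triv fun_upd_upd mem_Collect_eq)
  qed
  have "c' (\<alpha>(j := 0)) = 0"
  proof (rule insert.IH[of S'])
    show "finite S'" using insert.prems(1) by (simp add: S'_def)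
    show "\<beta> k = 0" if "\<beta> \<in> S'" "k \<notin> W" for \<beta> k
      using that insert.prems(2) by (auto simp: S'_def)
    show "\<alpha>(j := 0) \<in> S'" using insert.prems(4) by (auto simp: S'_def n_def)
    fix x
    have "(\<Sum>\<beta>\<in>S'. c' \<beta> * (\<Prod>k\<in>W. x k ^ \<beta> k)) = u x n"
      unfolding S'_def sum.reindex[OF inj] u_def
    proof (intro sum.cong refl)
      fix \<beta> assume \<beta>: "\<beta> \<in> {\<beta>\<in>S. \<beta> j = n}"
      have "(\<Prod>k\<in>W. x k ^ (\<beta>(j := 0)) k) = (\<Prod>k\<in>W. x k ^ \<beta> k)"
        using insert.hyps by (intro prod.cong) auto
      moreover have "c' (\<beta>(j := 0)) = c \<beta>" using \<beta> by (auto simp: c'_def)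
      ultimately show "((\<lambda>\<beta>. c' \<beta> * (\<Prod>k\<in>W. x k ^ \<beta> k)) \<circ> (\<lambda>\<beta>. \<beta>(j := 0))) \<beta> = c \<beta> * (\<Prod>k\<in>W. x k ^ \<beta> k)"
        by simp
    qed
    then show "(\<Sum>\<beta>\<in>S'. c' \<beta> * (\<Prod>k\<in>W. x k ^ \<beta> k)) = 0" using u0 by simp
  qed
  then show ?case by (simp add: c'_def n_def)
qed

lemma peval_inject:
  assumes "is_poly p" "is_poly q" "\<And>x. peval p x = peval q x"
  shows "p = q"
proof -
  define S where "S = {\<alpha>. p \<alpha> \<noteq> 0} \<union> {\<alpha>. q \<alpha> \<noteq> 0}"
  have S: "finite S" using assms by (simp add: S_def is_poly_def)
  have peval_S: "peval r x = (\<Sum>\<alpha>\<in>S. r \<alpha> * (\<Prod>k\<in>UNIV. x $ k ^ \<alpha> k))"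
    if "{\<alpha>. r \<alpha> \<noteq> 0} \<subseteq> S" for r :: "'a cpoly" and x
    unfolding peval_def using S that by (intro sum.mono_neutral_left) auto
  have "(\<Sum>\<alpha>\<in>S. (p \<alpha> - q \<alpha>) * (\<Prod>k\<in>UNIV. x k ^ \<alpha> k)) = 0" for x
    using assms(3)[of "\<chi> k. x k"] peval_S[of p] peval_S[of q]
    by (simp add: S_def left_diff_distrib sum_subtractf)
  then have "p \<alpha> - q \<alpha> = 0" if "\<alpha> \<in> S" for \<alpha>
    using monomials_independent[of UNIV S "\<lambda>\<alpha>. p \<alpha> - q \<alpha>" \<alpha>] S that by simp
  then have "p \<alpha> = q \<alpha>" for \<alpha> by (cases "\<alpha> \<in> S") (auto simp: S_def)
  then show ?thesis by (rule ext)
qed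

text \<open>The explicit composition satisfies the definite description, and
  \<open>peval_inject\<close> makes it the only solution.\<close>

lemma act_Y_eq:
  assumes "poly_system f"
  shows "act_Y Y f i = poly_comp (matrix_inv Y) (f i)"
proof -
  obtain D where D: "deg_le (f i) D"
    using assms by (auto simp: poly_system_def is_poly_iff_deg_le)
  show ?thesis unfolding act_Y_def
  proof (rule the_equality)
    show "is_poly (poly_comp (matrix_inv Y) (f i)) \<and>
        (\<forall>x. peval (poly_comp (matrix_inv Y) (f i)) x = peval (f i) (matrix_inv Y *v x))"
      using D by (auto simp: is_poly_iff_deg_le peval_poly_comp intro: deg_le_poly_comp)
    then show "q = poly_comp (matrix_inv Y) (f i)"
      if "is_poly q \<and> (\<forall>x. peval q x = peval (f i) (matrix_inv Y *v x))" for q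
      using that by (intro peval_inject) auto
  qed
qed

section \<open>The Bombieri--Weyl norm\<close>

lemma sum_swap3:
  "(\<Sum>s\<in>S. \<Sum>j\<in>A. \<Sum>k\<in>B. a s j k) = (\<Sum>j\<in>A. \<Sum>k\<in>B. \<Sum>s\<in>S. a s j k)"
  by (subst sum.swap) (intro sum.cong refl sum.swap)

text \<open>Summing over \<open>s\<close> first turns each slot into an entry of
  \<open>M ** cadj M'\<close>, so the two matrices enter only through this product.\<close>

lemma push_pairing:
  "(\<Sum>s\<in>words d. push M p s * cnj (push M' q s))
    = (\<Sum>r\<in>words d. \<Sum>r'\<in>words d. tens p r * cnj (tens q r') *
         (\<Prod>k<d. (M ** cadj M') $ (r ! k) $ (r' ! k)))"
proof -
  have "(\<Sum>s\<in>words d. push M p s * cnj (push M' q s))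
    = (\<Sum>s\<in>words d. \<Sum>r\<in>words d. \<Sum>r'\<in>words d. tens p r * cnj (tens q r') *
         (\<Prod>k<d. M $ (r ! k) $ (s ! k) * cnj (M' $ (r' ! k) $ (s ! k))))"
    by (intro sum.cong refl) (simp add: push_def sum_product prod.distrib mult_ac)
  also have "\<dots> = (\<Sum>r\<in>words d. \<Sum>r'\<in>words d. tens p r * cnj (tens q r') *
         (\<Sum>s\<in>words d. \<Prod>k<d. M $ (r ! k) $ (s ! k) * cnj (M' $ (r' ! k) $ (s ! k))))"
    unfolding sum_distrib_left by (rule sum_swap3)
  finally show ?thesis
    by (simp add: sum_words_prod[of "\<lambda>k a. M $ (_ ! k) $ a * cnj (M' $ (_ ! k) $ a)"] matrix_matrix_mult_def)
qed

text \<open>The analogue for the system index: only \<open>cadj X' ** X\<close> survives.\<close>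

lemma matrix_pairing:
  fixes X X' :: "complex^'m::finite^'k::finite"
  shows "(\<Sum>i\<in>UNIV. \<Sum>s\<in>S. (\<Sum>j\<in>UNIV. X $ i $ j * u j s) * cnj (\<Sum>j\<in>UNIV. X' $ i $ j * v j s))
    = (\<Sum>j\<in>UNIV. \<Sum>j'\<in>UNIV. (cadj X' ** X) $ j' $ j * (\<Sum>s\<in>S. u j s * cnj (v j' s)))"
proof -
  have "(\<Sum>s\<in>S. (\<Sum>j\<in>UNIV. X $ i $ j * u j s) * cnj (\<Sum>j\<in>UNIV. X' $ i $ j * v j s))
      = (\<Sum>j\<in>UNIV. \<Sum>j'\<in>UNIV. cnj (X' $ i $ j') * X $ i $ j * (\<Sum>s\<in>S. u j s * cnj (v j' s)))" for i
  proof -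
    have "(\<Sum>s\<in>S. (\<Sum>j\<in>UNIV. X $ i $ j * u j s) * cnj (\<Sum>j\<in>UNIV. X' $ i $ j * v j s))
      = (\<Sum>s\<in>S. \<Sum>j\<in>UNIV. \<Sum>j'\<in>UNIV. cnj (X' $ i $ j') * X $ i $ j * (u j s * cnj (v j' s)))"
      by (intro sum.cong refl) (simp add: sum_product mult_ac)
    then show ?thesis unfolding sum_distrib_left by (rule trans[OF _ sum_swap3])
  qed
  then have "(\<Sum>i\<in>UNIV. \<Sum>s\<in>S. (\<Sum>j\<in>UNIV. X $ i $ j * u j s) * cnj (\<Sum>j\<in>UNIV. X' $ i $ j * v j s))
      = (\<Sum>i\<in>UNIV. \<Sum>j\<in>UNIV. \<Sum>j'\<in>UNIV. cnj (X' $ i $ j') * X $ i $ j * (\<Sum>s\<in>S. u j s * cnj (v j' s)))"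
    by (rule sum.cong[OF refl])
  also have "\<dots> = (\<Sum>j\<in>UNIV. \<Sum>j'\<in>UNIV. \<Sum>i\<in>UNIV.
      cnj (X' $ i $ j') * X $ i $ j * (\<Sum>s\<in>S. u j s * cnj (v j' s)))"
    by (rule sum_swap3)
  finally show ?thesis
    by (simp add: matrix_matrix_mult_def sum_distrib_right)
qed

text \<open>Tensor coordinates of \<open>X\<close> acting on the system \<open>f\<close> composed
  with \<open>M\<close>; \<open>M\<close> will be the inverse of the second group component.\<close>

definition act_tens ::
  "complex^'m^'m \<Rightarrow> complex^'n^'n \<Rightarrow> ('m::finite \<Rightarrow> 'n::finite cpoly) \<Rightarrow> 'm \<Rightarrow> 'n list \<Rightarrow> complex" where
  "act_tens X M f i s = (\<Sum>j\<in>UNIV. X $ i $ j * push M (f j) s)"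

text \<open>The squared Bombieri--Weyl norm of the transformed system, once \<open>D\<close> bounds
  the degrees.\<close>

definition energy ::
  "nat \<Rightarrow> complex^'m^'m \<Rightarrow> complex^'n^'n \<Rightarrow> ('m::finite \<Rightarrow> 'n::finite cpoly) \<Rightarrow> real" where
  "energy D X M f = (\<Sum>d\<le>D. \<Sum>i\<in>UNIV. \<Sum>s\<in>words d. (cmod (act_tens X M f i s))\<^sup>2)"

text \<open>Polarisation of \<open>energy\<close>: two transforms of the same system are
  paired.\<close>

definition pairing ::
  "nat \<Rightarrow> complex^'m^'m \<Rightarrow> complex^'n^'n \<Rightarrow> complex^'m^'m \<Rightarrow> complex^'n^'n
    \<Rightarrow> ('m::finite \<Rightarrow> 'n::finite cpoly) \<Rightarrow> complex" where
  "pairing D X M X' M' f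
     = (\<Sum>d\<le>D. \<Sum>i\<in>UNIV. \<Sum>s\<in>words d. act_tens X M f i s * cnj (act_tens X' M' f i s))"

lemma energy_nonneg: "0 \<le> energy D X M f"
  by (simp add: energy_def sum_nonneg)

lemma pairing_self: "pairing D X M X M f = of_real (energy D X M f)"
  by (simp add: pairing_def energy_def complex_norm_square[symmetric])

text \<open>Both unitary invariance and log-convexity rest on this dependence on the two Gram
  products alone.\<close>

lemma pairing_cong:
  assumes "cadj X\<^sub>1' ** X\<^sub>1 = cadj X\<^sub>2' ** X\<^sub>2" "M\<^sub>1 ** cadj M\<^sub>1' = M\<^sub>2 ** cadj M\<^sub>2'"
  shows "pairing D X\<^sub>1 M\<^sub>1 X\<^sub>1' M\<^sub>1' f = pairing D X\<^sub>2 M\<^sub>2 X\<^sub>2' M\<^sub>2' f"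
  unfolding pairing_def act_tens_def matrix_pairing push_pairing assms ..

lemma pairing_Cauchy_Schwarz:
  "(cmod (pairing D X M X' M' f))\<^sup>2 \<le> energy D X M f * energy D X' M' f"
proof -
  \<comment> \<open>The triple sum is flattened to one finite index set so that the real
    Cauchy--Schwarz inequality applies to the moduli.\<close>
  define J :: "(nat \<times> 'a \<times> 'b list) set" where "J = Sigma {..D} (\<lambda>d. UNIV \<times> words d)"
  have J: "(\<Sum>d\<le>D. \<Sum>i\<in>UNIV. \<Sum>s\<in>words d. h i s) = (\<Sum>(d, i, s)\<in>J. h i s)"
    for h :: "'a \<Rightarrow> 'b list \<Rightarrow> 'c::comm_monoid_add"
    unfolding J_def by (simp add: sum.Sigma sum.cartesian_product)
  define u where "u = (\<lambda>(d::nat, i, s). cmod (act_tens X M f i s))"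
  define v where "v = (\<lambda>(d::nat, i, s). cmod (act_tens X' M' f i s))"
  have "cmod (pairing D X M X' M' f) \<le> (\<Sum>x\<in>J. u x * v x)"
    unfolding pairing_def J
    by (rule order.trans[OF norm_sum]) (simp add: u_def v_def case_prod_beta norm_mult)
  then have "(cmod (pairing D X M X' M' f))\<^sup>2 \<le> (\<Sum>x\<in>J. u x * v x)\<^sup>2"
    by (rule power_mono) simp
  also have "\<dots> \<le> (\<Sum>x\<in>J. (u x)\<^sup>2) * (\<Sum>x\<in>J. (v x)\<^sup>2)"
    by (rule Cauchy_Schwarz_ineq_sum)
  also have "\<dots> = energy D X M f * energy D X' M' f"
    unfolding energy_def J by (simp add: u_def v_def case_prod_beta)
  finally show ?thesis .
qed

text \<open>Linear substitutions and linear combinations do not raise degrees, so one bound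
  \<open>D\<close> serves all group elements, in particular a whole geodesic.\<close>

lemma bw_norm_act:
  fixes f :: "'m::finite \<Rightarrow> 'n::finite cpoly"
  assumes "poly_system f"
  obtains D where "\<And>X Y. bw_norm (act (X, Y) f) = sqrt (energy D X (matrix_inv Y) f)"
proof -
  obtain E where E: "\<And>i. deg_le (f i) (E i)"
    using assms unfolding poly_system_def is_poly_iff_deg_le by metis
  define D where "D = Max (range E)"
  have D: "deg_le (f i) D" for i
    by (rule deg_le_mono[OF E]) (simp add: D_def)
  have "bw_norm (act (X, Y) f) = sqrt (energy D X (matrix_inv Y) f)" for X Y
  proof -
    have act: "act (X, Y) f i \<alpha> = (\<Sum>j\<in>UNIV. X $ i $ j * poly_comp (matrix_inv Y) (f j) \<alpha>)" for i \<alpha>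
      by (simp add: act_def act_X_def act_Y_eq[OF assms])
    have "deg_le (act (X, Y) f i) D" for i
      unfolding deg_le_def
    proof (intro allI impI)
      fix \<alpha> assume "act (X, Y) f i \<alpha> \<noteq> 0"
      then obtain j where "poly_comp (matrix_inv Y) (f j) \<alpha> \<noteq> 0"
        unfolding act by (metis (no_types, lifting) mult_eq_0_iff sum.not_neutral_contains_not_neutral)
      then show "(\<Sum>k\<in>UNIV. \<alpha> k) \<le> D"
        using deg_le_poly_comp[OF D] unfolding deg_le_def by blast
    qed
    then have "bw_norm (act (X, Y) f)
        = sqrt (\<Sum>i\<in>UNIV. \<Sum>d\<le>D. \<Sum>s\<in>words d. (cmod (tens (act (X, Y) f i) s))\<^sup>2)"
      by (rule bw_norm_eq_tens)
    moreover have "tens (act (X, Y) f i) s = act_tens X (matrix_inv Y) f i s" for i s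
      unfolding act_tens_def tens_poly_comp[symmetric]
      by (simp add: tens_def act sum_distrib_left mult_ac)
    ultimately show ?thesis
      unfolding energy_def by (subst sum.swap) simp
  qed
  then show ?thesis by (rule that)
qed

section \<open>Log-convexity of the Bombieri--Weyl norm along geodesics\<close>

text \<open>The midpoint inequality makes second differences of \<open>ln (g t)\<close> nonnegative,
  and continuity upgrades this to convexity.\<close>

lemma convex_on_ln_if_midpoint_log_convex:
  fixes g :: "real \<Rightarrow> real"
  assumes pos: "\<And>t. g t > 0"
    and cont: "continuous_on UNIV g"
    and mid: "\<And>t h. (g t)\<^sup>2 \<le> g (t + h) * g (t - h)"
  shows "convex_on UNIV (\<lambda>t. ln (g t))"
proof (rule convex_on_UNIV_second_difference)
  show "continuous_on UNIV (\<lambda>t. ln (g t))"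
    using cont pos by (auto intro!: continuous_intros simp: less_imp_neq[symmetric])
  fix t e :: real
  assume e: "e > 0"
  have "2 * ln (g t) \<le> ln (g (t + h)) + ln (g (t - h))" for h
  proof -
    have "2 * ln (g t) = ln ((g t)\<^sup>2)" using pos by (simp add: ln_realpow)
    also have "\<dots> \<le> ln (g (t + h) * g (t - h))" using mid pos by (simp add: less_imp_neq[symmetric])
    also have "\<dots> = ln (g (t + h)) + ln (g (t - h))" using pos by (simp add: ln_mult_pos)
    finally show ?thesis .
  qed
  moreover have "0 \<le> e * h\<^sup>2" for h :: real using e by simp
  ultimately show "\<forall>\<^sub>F h in at_right 0. 2 * ln (g t) \<le> ln (g (t + h)) + ln (g (t - h)) + e * h\<^sup>2"
    by (intro always_eventually allI) (smt (verit))
qed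

lemma continuous_on_mexp_real: "continuous_on UNIV (\<lambda>t::real. mexp (t *\<^sub>R H))"
proof -
  have "continuous_on UNIV (\<lambda>t::real. mexp (t *\<^sub>R H) $ i $ j)" for i j
    unfolding scaleR_eq_cscale
    by (rule continuous_on_compose2[OF continuous_on_mexp]) (auto intro!: continuous_intros)
  then show ?thesis unfolding continuous_on_def by (blast intro: vec_tendstoI)
qed

lemma cadj_mexp_real: "hermitian H \<Longrightarrow> cadj (mexp (t *\<^sub>R H)) = mexp (t *\<^sub>R H)"
  by (simp add: scaleR_eq_cscale cadj_mexp hermitian_def)

lemma mexp_add_real: "mexp (a *\<^sub>R H) ** mexp (b *\<^sub>R H) = mexp ((a + b) *\<^sub>R H)"
  by (simp add: scaleR_eq_cscale mexp_add)

lemma matrix_inv_mexp_mult: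
  "invertible Y \<Longrightarrow> matrix_inv (mexp (t *\<^sub>R H) ** Y) = matrix_inv Y ** mexp (- t *\<^sub>R H)"
  by (simp only: scaleR_eq_cscale matrix_inv_matrix_mult[OF invertible_mexp] matrix_inv_mexp of_real_minus)

text \<open>By the pairing congruence the pairing at parameters \<open>a\<close> and \<open>b\<close> depends on \<open>a + b\<close> only, since
  \<open>H1\<close> and \<open>H2\<close> are Hermitian; Cauchy--Schwarz at \<open>t + h\<close>, \<open>t - h\<close> is then midpoint log-convexity.\<close>
lemma energy_log_convex:
  assumes H: "hermitian H1" "hermitian H2"
  shows "convex_on UNIV (\<lambda>t::real. ln (energy D (mexp (t *\<^sub>R H1) ** X) (M ** mexp (- t *\<^sub>R H2)) f))"
proof -
  define g where "g = (\<lambda>t::real. energy D (mexp (t *\<^sub>R H1) ** X) (M ** mexp (- t *\<^sub>R H2)) f)"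
  define P where "P = (\<lambda>a b::real. pairing D (mexp (a *\<^sub>R H1) ** X) (M ** mexp (- a *\<^sub>R H2))
      (mexp (b *\<^sub>R H1) ** X) (M ** mexp (- b *\<^sub>R H2)) f)"
  have P_diag: "P t t = of_real (g t)" for t
    by (simp add: P_def g_def pairing_self)
  have P_cs: "(cmod (P a b))\<^sup>2 \<le> g a * g b" for a b
    unfolding P_def g_def by (rule pairing_Cauchy_Schwarz)
  have P_cong: "P a b = P a' b'" if "a + b = a' + b'" for a b a' b'
    unfolding P_def
  proof (rule pairing_cong)
    have 1: "cadj (mexp (b *\<^sub>R H1) ** X) ** (mexp (a *\<^sub>R H1) ** X)
        = cadj X ** mexp ((a + b) *\<^sub>R H1) ** X" for a b
    proof -
      have "cadj (mexp (b *\<^sub>R H1) ** X) ** (mexp (a *\<^sub>R H1) ** X)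
          = cadj X ** (mexp (b *\<^sub>R H1) ** mexp (a *\<^sub>R H1)) ** X"
        by (simp only: cadj_matrix_mult cadj_mexp_real[OF H(1)] matrix_mul_assoc)
      then show ?thesis by (simp only: mexp_add_real add.commute)
    qed
    have 2: "M ** mexp (- a *\<^sub>R H2) ** cadj (M ** mexp (- b *\<^sub>R H2))
        = M ** mexp (- (a + b) *\<^sub>R H2) ** cadj M" for a b
    proof -
      have "M ** mexp (- a *\<^sub>R H2) ** cadj (M ** mexp (- b *\<^sub>R H2))
          = M ** (mexp (- a *\<^sub>R H2) ** mexp (- b *\<^sub>R H2)) ** cadj M"
        by (simp only: cadj_matrix_mult cadj_mexp_real[OF H(2)] matrix_mul_assoc)
      then show ?thesis by (simp only: mexp_add_real minus_add_distrib)
    qed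
    show "cadj (mexp (b *\<^sub>R H1) ** X) ** (mexp (a *\<^sub>R H1) ** X)
        = cadj (mexp (b' *\<^sub>R H1) ** X) ** (mexp (a' *\<^sub>R H1) ** X)"
      unfolding 1 that ..
    show "M ** mexp (- a *\<^sub>R H2) ** cadj (M ** mexp (- b *\<^sub>R H2))
        = M ** mexp (- a' *\<^sub>R H2) ** cadj (M ** mexp (- b' *\<^sub>R H2))"
      unfolding 2 that ..
  qed
  have g0: "g t \<ge> 0" for t by (simp add: g_def energy_nonneg)
  show ?thesis
  proof (cases "\<exists>t. g t = 0")
    case True
    then obtain t where t: "g t = 0" by blast
    have "g s = 0" for s
    proof -
      \<comment> \<open>The partner \<open>2 * s - t\<close> keeps the parameter sum at
        \<open>2 * s\<close>, so a single zero of \<open>g\<close> forces all its values to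
        vanish.\<close>
      have "P s s = P t (2 * s - t)" by (rule P_cong) simp
      also have "\<dots> = 0" using P_cs[of t "2 * s - t"] t by simp
      finally show ?thesis by (simp add: P_diag)
    qed
    \<comment> \<open>In this degenerate case the logarithm is constant, by the convention
      \<open>ln 0 = 0\<close>.\<close>
    then have "convex_on UNIV (\<lambda>t. ln (g t))" by (simp add: convex_on_const)
    then show ?thesis by (simp add: g_def)
  next
    case False
    have "convex_on UNIV (\<lambda>t. ln (g t))"
    proof (rule convex_on_ln_if_midpoint_log_convex)
      show "g t > 0" for t using False g0[of t] by (simp add: less_le)
      have "continuous_on UNIV (\<lambda>t::real. mexp (- t *\<^sub>R H2))"
        by (rule continuous_on_compose2[OF continuous_on_mexp_real]) (auto intro!: continuous_intros)
      then show "continuous_on UNIV g"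
        unfolding g_def energy_def act_tens_def push_def matrix_matrix_mult_def
        by (simp, intro continuous_intros continuous_on_mexp_real) auto
      fix t h
      have "P (t + h) (t - h) = P t t" by (rule P_cong) simp
      then show "(g t)\<^sup>2 \<le> g (t + h) * g (t - h)"
        using P_cs[of "t + h" "t - h"] by (simp add: P_diag)
    qed
    then show ?thesis by (simp add: g_def)
  qed
qed

text \<open>At \<open>x = 0\<close> both sides are 0 by the convention
  \<open>ln 0 = 0\<close>.\<close>

lemma ln_sqrt_nonneg: "x \<ge> 0 \<Longrightarrow> ln (sqrt x) = ln x / 2"
  by (cases "x = 0") (auto simp: ln_sqrt)

lemma bw_norm_act_log_convex:
  assumes "poly_system f" "hermitian H1" "hermitian H2" "invertible Y"
  shows "convex_on UNIV (\<lambda>t::real. ln (bw_norm (act (mexp (t *\<^sub>R H1) ** X, mexp (t *\<^sub>R H2) ** Y) f)))"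
proof -
  obtain D where D: "\<And>X Y. bw_norm (act (X, Y) f) = sqrt (energy D X (matrix_inv Y) f)"
    using bw_norm_act[OF assms(1)] by blast
  have "convex_on UNIV (\<lambda>t::real. 1 / 2 * ln (energy D (mexp (t *\<^sub>R H1) ** X) (matrix_inv Y ** mexp (- t *\<^sub>R H2)) f))"
    by (intro convex_on_cmul energy_log_convex assms) simp
  then show ?thesis
    unfolding D matrix_inv_mexp_mult[OF assms(4)] by (simp add: ln_sqrt_nonneg energy_nonneg)
qed

text \<open>A unitary factor cancels against its adjoint in both Gram products, and
  \<open>pairing_self\<close> returns from pairings to norms.\<close>

lemma bw_norm_act_unitary:
  assumes "poly_system f" "unitary U" "unitary V" "invertible Y"
  shows "bw_norm (act (U ** X, V ** Y) f) = bw_norm (act (X, Y) f)"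
proof -
  obtain D where D: "\<And>X Y. bw_norm (act (X, Y) f) = sqrt (energy D X (matrix_inv Y) f)"
    using bw_norm_act[OF assms(1)] by blast
  define M where "M = matrix_inv Y"
  have M: "matrix_inv (V ** Y) = M ** cadj V"
    using assms by (simp add: matrix_inv_matrix_mult unitary_invertible matrix_inv_unitary M_def)
  have "pairing D (U ** X) (M ** cadj V) (U ** X) (M ** cadj V) f = pairing D X M X M f"
  proof (rule pairing_cong)
    have "cadj (U ** X) ** (U ** X) = cadj X ** (cadj U ** U) ** X"
      by (simp only: cadj_matrix_mult matrix_mul_assoc)
    then show "cadj (U ** X) ** (U ** X) = cadj X ** X" using assms by (simp add: unitary_def)
    have "M ** cadj V ** cadj (M ** cadj V) = M ** (cadj V ** V) ** cadj M"
      by (simp only: cadj_matrix_mult cadj_cadj matrix_mul_assoc)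
    then show "M ** cadj V ** cadj (M ** cadj V) = M ** cadj M" using assms by (simp add: unitary_def)
  qed
  then show ?thesis by (simp add: D M pairing_self flip: M_def)
qed

section \<open>Geodesic convexity\<close>

lemma iLieK_hermitian:
  assumes "H \<in> iLieK G"
  shows "hermitian (fst H)" "hermitian (snd H)"
  using assms by (simp_all add: iLieK_def)

lemma Kgrp_unitary:
  assumes "k \<in> Kgrp G"
  shows "unitary (fst k)" "unitary (snd k)"
  using assms by (simp_all add: Kgrp_def)

lemma symmetric_subgroup_invertible:
  assumes "symmetric_subgroup G" "g \<in> G"
  shows "invertible (fst g)" "invertible (snd g)"
  using assms by (auto simp: symmetric_subgroup_def GLpair_def)

lemma geodesically_convex_add:
  assumes "geodesically_convex G F" "geodesically_convex G F'"
  shows "geodesically_convex G (\<lambda>g. F g + F' g)"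
  using assms unfolding geodesically_convex_def by (auto intro: convex_on_add)

lemma uin_unitary_conj:
  assumes "unitarily_invariant_norm N" "unitary U" "unitary V" "invertible X" "invertible Y"
  shows "N ((U ** X) ** A ** matrix_inv (V ** Y)) = N (X ** A ** matrix_inv Y)"
proof -
  have "(U ** X) ** A ** matrix_inv (V ** Y) = U ** (X ** A ** matrix_inv Y) ** cadj V"
    using assms by (simp add: matrix_inv_matrix_mult unitary_invertible matrix_inv_unitary matrix_mul_assoc)
  then show ?thesis using assms by (simp add: uin_unitary unitary_cadj)
qed

text \<open>Regrouping puts \<open>X ** A ** matrix_inv Y\<close> between the two exponentials, as
  the fixed matrix of \<open>uin_log_convex\<close>.\<close>

lemma uin_mexp_log_convex:
  assumes "unitarily_invariant_norm N" "hermitian H1" "hermitian H2" "invertible Y"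
  shows "convex_on UNIV (\<lambda>t::real. ln (N ((mexp (t *\<^sub>R H1) ** X) ** A ** matrix_inv (mexp (t *\<^sub>R H2) ** Y))))"
proof -
  have "(mexp (t *\<^sub>R H1) ** X) ** A ** matrix_inv (mexp (t *\<^sub>R H2) ** Y)
      = mexp (t *\<^sub>R H1) ** (X ** A ** matrix_inv Y) ** mexp (- t *\<^sub>R H2)" for t
    by (simp only: matrix_inv_mexp_mult[OF assms(4)] matrix_mul_assoc)
  then show ?thesis using uin_log_convex[OF assms(1-3)] by simp
qed

lemma geodesically_convex_uin_left:
  fixes G :: "('m::finite,'n::finite) gpair set"
  assumes G: "symmetric_subgroup G" and N: "unitarily_invariant_norm N"
  shows "geodesically_convex G (\<lambda>g. ln (N (fst g ** A ** matrix_inv (snd g))))"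
  unfolding geodesically_convex_def
  using Kgrp_unitary[of _ G] symmetric_subgroup_invertible[OF G] iLieK_hermitian[of _ G]
  by (simp add: pmul_def pexp_def uin_unitary_conj[OF N] uin_mexp_log_convex[OF N])

text \<open>The two components of the group exchange roles here, which is the shape of the
  pseudoinverse summand.\<close>

lemma geodesically_convex_uin_right:
  fixes G :: "('m::finite,'n::finite) gpair set"
  assumes G: "symmetric_subgroup G" and N: "unitarily_invariant_norm N"
  shows "geodesically_convex G (\<lambda>g. ln (N (snd g ** A ** matrix_inv (fst g))))"
  unfolding geodesically_convex_def
  using Kgrp_unitary[of _ G] symmetric_subgroup_invertible[OF G] iLieK_hermitian[of _ G]
  by (simp add: pmul_def pexp_def uin_unitary_conj[OF N] uin_mexp_log_convex[OF N])

lemma geodesically_convex_bw_norm: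
  fixes G :: "('m::finite,'n::finite) gpair set"
  assumes G: "symmetric_subgroup G" and f: "poly_system f"
  shows "geodesically_convex G (\<lambda>g. ln (bw_norm (act g f)))"
  unfolding geodesically_convex_def
  using Kgrp_unitary[of _ G] symmetric_subgroup_invertible[OF G] iLieK_hermitian[of _ G]
    bw_norm_act_unitary[OF f, where X = "fst g" and Y = "snd g" for g]
  by (simp add: pmul_def pexp_def bw_norm_act_log_convex[OF f])

theorem theorem2p1:
  fixes G :: "('m::finite,'n::finite) gpair set"
    and N1 :: "complex^'n^'m \<Rightarrow> real"
    and N2 :: "complex^'m^'n \<Rightarrow> real"
  assumes "symmetric_subgroup G"
    and "unitarily_invariant_norm N1"
    and "unitarily_invariant_norm N2"
  shows "(\<forall>A :: complex^'n^'m. A \<noteq> 0 \<longrightarrow>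
            geodesically_convex G
              (\<lambda>(X, Y). ln (N1 (X ** A ** matrix_inv Y)) + ln (N2 (Y ** pinv A ** matrix_inv X))))
       \<and> (\<forall>(f :: 'm \<Rightarrow> 'n cpoly) (\<xi> :: complex^'n).
            poly_system f \<and> (\<exists>i \<alpha>. f i \<alpha> \<noteq> 0) \<and> jac_matrix f \<xi> \<noteq> 0 \<longrightarrow>
            geodesically_convex G
              (\<lambda>(X, Y). ln (bw_norm (act (X, Y) f))
                         + ln (N2 (Y ** pinv (jac_matrix f \<xi>) ** matrix_inv X))))"
  \<comment> \<open>In both parts the pseudoinverse enters as a fixed middle matrix, and the two
    summands are convex separately.\<close>
  unfolding case_prod_unfold prod.collapse using assms
  by (auto intro!: geodesically_convex_add geodesically_convex_uin_left
      geodesically_convex_uin_right geodesically_convex_bw_norm)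

end
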